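(* Let $G=(V(G),E(G))$ be a finite simple connected graph with vertex set $V(G)=\{x_1,\ldots,x_n\}$, let $K$ be a field, $R=K[x_1,\ldots,x_n]$, and let $J(G)=\bigcap_{\{x_i,x_j\}\in E(G)}(x_i,x_j)\subset R$ be the cover ideal of $G$. Then $J(G)$ has the nearly copersistence property if and only if $G$ is either a bipartite graph or an almost bipartite graph.
   Context: A monomial ideal $I$ in a polynomial ring $R=K[x_1,\ldots,x_n]$ over a field $K$ has the nearly copersistence property if there exist a positive integer $s$ and a monomial prime ideal $\mathfrak{p}$ of $R$ such that $\mathrm{Ass}_R(R/I^m)\cup\{\mathfrak{p}\}\supseteq \mathrm{Ass}_R(R/I^{m+1})$ for all $1\le m\le s$, and $\mathrm{Ass}_R(R/I^m)\supseteq\mathrm{Ass}_R(R/I^{m+1})$ for all $m\ge s+1$. A finite simple connected graph is called almost bipartite if it has exactly one induced subgraph that is an odd cycle. *)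

theory Defs
  imports Main "HOL-Library.Poly_Mapping"
begin

type_synonym ('v, 'k) mpoly = "('v \<Rightarrow>\<^sub>0 nat) \<Rightarrow>\<^sub>0 'k"

definition var :: "'v \<Rightarrow> ('v, 'k::comm_ring_1) mpoly" where
  "var v = Poly_Mapping.single (Poly_Mapping.single v 1) 1"

definition is_ideal :: "'a::comm_ring_1 set \<Rightarrow> bool" where
  "is_ideal I \<longleftrightarrow> 0 \<in> I \<and> (\<forall>a\<in>I. \<forall>b\<in>I. a + b \<in> I) \<and> (\<forall>r. \<forall>a\<in>I. r * a \<in> I)"

definition ideal_gen :: "'a::comm_ring_1 set \<Rightarrow> 'a set" where
  "ideal_gen S = \<Inter>{I. is_ideal I \<and> S \<subseteq> I}"

definition ideal_prod :: "'a::comm_ring_1 set \<Rightarrow> 'a set \<Rightarrow> 'a set" where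
  "ideal_prod I J = ideal_gen {a * b | a b. a \<in> I \<and> b \<in> J}"

fun ideal_pow :: "'a::comm_ring_1 set \<Rightarrow> nat \<Rightarrow> 'a set" where
  "ideal_pow I 0 = UNIV"
| "ideal_pow I (Suc m) = ideal_prod (ideal_pow I m) I"

definition prime_ideal :: "'a::comm_ring_1 set \<Rightarrow> bool" where
  "prime_ideal P \<longleftrightarrow> is_ideal P \<and> P \<noteq> UNIV \<and> (\<forall>a b. a * b \<in> P \<longrightarrow> a \<in> P \<or> b \<in> P)"

text \<open>Colon ideal I : f, i.e. the annihilator of the class of f in R/I.\<close>
definition colon :: "'a::comm_ring_1 set \<Rightarrow> 'a \<Rightarrow> 'a set" where
  "colon I f = {g. g * f \<in> I}"

text \<open>Ass_R(R/I): prime ideals that are annihilators of elements of R/I.\<close>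
definition Ass :: "'a::comm_ring_1 set \<Rightarrow> 'a set set" where
  "Ass I = {P. prime_ideal P \<and> (\<exists>f. P = colon I f)}"

definition monomial_prime :: "('v, 'k::field) mpoly set \<Rightarrow> bool" where
  "monomial_prime P \<longleftrightarrow> (\<exists>A. P = ideal_gen (var ` A))"

definition nearly_copersistent :: "('v, 'k::field) mpoly set \<Rightarrow> bool" where
  "nearly_copersistent I \<longleftrightarrow>
     (\<exists>s::nat. \<exists>p. s \<ge> 1 \<and> monomial_prime p \<and>
        (\<forall>m. 1 \<le> m \<and> m \<le> s \<longrightarrow> Ass (ideal_pow I (m+1)) \<subseteq> Ass (ideal_pow I m) \<union> {p}) \<and>
        (\<forall>m. m \<ge> s + 1 \<longrightarrow> Ass (ideal_pow I (m+1)) \<subseteq> Ass (ideal_pow I m)))"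

definition simple_graph :: "('v \<Rightarrow> 'v \<Rightarrow> bool) \<Rightarrow> bool" where
  "simple_graph E \<longleftrightarrow> (\<forall>u v. E u v \<longrightarrow> E v u) \<and> (\<forall>v. \<not> E v v)"

definition connected_graph :: "('v \<Rightarrow> 'v \<Rightarrow> bool) \<Rightarrow> bool" where
  "connected_graph E \<longleftrightarrow> (\<forall>u v. E\<^sup>*\<^sup>* u v)"

definition bipartite :: "('v \<Rightarrow> 'v \<Rightarrow> bool) \<Rightarrow> bool" where
  "bipartite E \<longleftrightarrow> (\<exists>c :: 'v \<Rightarrow> bool. \<forall>u v. E u v \<longrightarrow> c u \<noteq> c v)"

definition induced_odd_cycle :: "('v \<Rightarrow> 'v \<Rightarrow> bool) \<Rightarrow> 'v set \<Rightarrow> bool" where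
  "induced_odd_cycle E S \<longleftrightarrow>
     (\<exists>k f. odd k \<and> k \<ge> 3 \<and> bij_betw f {..<k} S \<and>
        (\<forall>i<k. \<forall>j<k. E (f i) (f j) \<longleftrightarrow> (j = Suc i mod k \<or> i = Suc j mod k)))"

definition almost_bipartite :: "('v \<Rightarrow> 'v \<Rightarrow> bool) \<Rightarrow> bool" where
  "almost_bipartite E \<longleftrightarrow> (\<exists>!S. induced_odd_cycle E S)"

definition cover_ideal :: "('v \<Rightarrow> 'v \<Rightarrow> bool) \<Rightarrow> ('v, 'k::field) mpoly set" where
  "cover_ideal E = \<Inter>{ideal_gen {var u, var v} | u v. E u v}"

end

theory Submission
  imports Defs
begin

text \<open>
  For a set \<open>A\<close> of variables and a threshold \<open>t\<close>, the monomials of \<open>A\<close>-degree at least \<open>t\<close>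
  span an ideal that is primary to the prime \<open>p A\<close> generated by \<open>A\<close>. If \<open>J\<^sup>m\<close> is cut out by
  finitely many such conditions, then all its associated primes are among the corresponding \<open>p A\<close>.

  A monomial lies in \<open>J\<^sup>m\<close> iff its exponent dominates a sum of \<open>m\<close> vertex covers. If \<open>G\<close> is
  bipartite this means that the degree on every edge is at least \<open>m\<close>. If \<open>G\<close> has a unique induced odd
  cycle \<open>S\<close>, of length \<open>2 * l + 1\<close>, the only further condition is that the degree on \<open>S\<close> is at least
  \<open>m * (l + 1)\<close>. To see this pass to complements, that is, to decompositions of a weight \<open>w\<close> into \<open>m\<close>
  independent sets, and fix \<open>v \<in> S\<close>; then \<open>G - v\<close> is bipartite. One splits \<open>w = p + q\<close>, where \<open>p\<close> is to
  be covered by \<open>w v\<close> independent sets containing \<open>v\<close> and \<open>q\<close> by the others, so that the bipartite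
  case applies to both. The constraints on \<open>p\<close> form a system of difference constraints, whose only
  possible obstruction is an odd closed walk through \<open>v\<close> of too large weight; chords reduce odd
  closed walks to \<open>S\<close>.

  Conversely, every induced odd cycle gives an associated prime of \<open>J\<^sup>m\<close> for every \<open>m \<ge> 2\<close>, but not
  of \<open>J\<close>, so two such cycles contradict near copersistence already at \<open>m = 1\<close>.
\<close>

abbreviation lookup :: "('a \<Rightarrow>\<^sub>0 'b::zero) \<Rightarrow> 'a \<Rightarrow> 'b" where
  "lookup \<equiv> Poly_Mapping.lookup"

abbreviation keys :: "('a \<Rightarrow>\<^sub>0 'b::zero) \<Rightarrow> 'a set" where
  "keys \<equiv> Poly_Mapping.keys"

abbreviation single :: "'a \<Rightarrow> 'b::zero \<Rightarrow> 'a \<Rightarrow>\<^sub>0 'b" where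
  "single \<equiv> Poly_Mapping.single"

section \<open>Monomial ideals\<close>

definition mon_ideal :: "('v \<Rightarrow>\<^sub>0 nat) set \<Rightarrow> ('v, 'k::field) mpoly set" where
  "mon_ideal U = {f. keys f \<subseteq> U}"

definition upclosed :: "('v \<Rightarrow>\<^sub>0 nat) set \<Rightarrow> bool" where
  "upclosed U \<longleftrightarrow> (\<forall>a\<in>U. \<forall>b. b + a \<in> U)"

definition weight_on :: "'v set \<Rightarrow> ('v \<Rightarrow>\<^sub>0 nat) \<Rightarrow> nat" where
  "weight_on A a = (\<Sum>v\<in>A. lookup a v)"

lemma weight_on_add: "weight_on A (a + b) = weight_on A a + weight_on A b"
  by (simp add: weight_on_def lookup_add sum.distrib)

lemma is_ideal_mon_ideal:
  assumes "upclosed U"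
  shows "is_ideal (mon_ideal U)"
  unfolding is_ideal_def mon_ideal_def
proof (intro conjI ballI allI)
  fix r f :: "('a, 'k::field) mpoly" assume "f \<in> {f. keys f \<subseteq> U}"
  then show "r * f \<in> {f. keys f \<subseteq> U}"
    using assms keys_mult[of r f] unfolding upclosed_def by blast
next
  fix f g :: "('a, 'k::field) mpoly" assume "f \<in> {f. keys f \<subseteq> U}" "g \<in> {f. keys f \<subseteq> U}"
  then show "f + g \<in> {f. keys f \<subseteq> U}"
    using keys_add[of f g] by blast
qed auto

lemma is_ideal_sum:
  assumes "is_ideal I" "\<And>x. x \<in> X \<Longrightarrow> f x \<in> I"
  shows "sum f X \<in> I"
  using assms(2) by (induction X rule: infinite_finite_induct)
    (use assms(1) in \<open>auto simp: is_ideal_def\<close>)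

lemma is_ideal_ideal_gen: "is_ideal (ideal_gen S)"
  unfolding ideal_gen_def is_ideal_def by blast

lemma ideal_gen_superset: "S \<subseteq> ideal_gen S"
  unfolding ideal_gen_def by blast

lemma ideal_gen_least: "is_ideal I \<Longrightarrow> S \<subseteq> I \<Longrightarrow> ideal_gen S \<subseteq> I"
  unfolding ideal_gen_def by blast

lemma sum_monomials: "f = (\<Sum>a\<in>keys f. single a (lookup f a))"
  by (rule poly_mapping_eqI)
    (auto simp: lookup_sum lookup_single when_def not_in_keys_iff_lookup_eq_zero)

lemma in_ideal_monomialsI:
  fixes f :: "('v, 'k::field) mpoly"
  assumes "is_ideal I" "\<And>a. a \<in> keys f \<Longrightarrow> single a 1 \<in> I"
  shows "f \<in> I"
proof -
  have "single a (lookup f a) \<in> I" if "a \<in> keys f" for a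
  proof -
    have "single 0 (lookup f a) * single a 1 \<in> I"
      using assms that unfolding is_ideal_def by blast
    then show ?thesis by (simp add: mult_single)
  qed
  then show ?thesis
    using is_ideal_sum[OF assms(1)] sum_monomials[of f] by metis
qed

lemma single_in_mon_ideal [simp]: "(single a 1 :: ('v, 'k::field) mpoly) \<in> mon_ideal U \<longleftrightarrow> a \<in> U"
  by (simp add: mon_ideal_def)

lemma upclosed_weight_ge: "upclosed {a. t \<le> weight_on A a}"
  by (auto simp: upclosed_def weight_on_add)

lemma ideal_gen_var:
  fixes A :: "'v::finite set"
  shows "ideal_gen (var ` A) = (mon_ideal {a. 1 \<le> weight_on A a} :: ('v, 'k::field) mpoly set)"
proof
  show "ideal_gen (var ` A) \<subseteq> (mon_ideal {a. 1 \<le> weight_on A a} :: ('v, 'k) mpoly set)"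
  proof (rule ideal_gen_least[OF is_ideal_mon_ideal[OF upclosed_weight_ge]])
    have "1 \<le> weight_on A (single v 1)" if "v \<in> A" for v
      using that by (simp add: weight_on_def lookup_single when_def)
    then show "var ` A \<subseteq> (mon_ideal {a. 1 \<le> weight_on A a} :: ('v, 'k) mpoly set)"
      by (auto simp: var_def)
  qed
next
  show "(mon_ideal {a. 1 \<le> weight_on A a} :: ('v, 'k) mpoly set) \<subseteq> ideal_gen (var ` A)"
  proof
    fix f :: "('v, 'k) mpoly" assume f: "f \<in> mon_ideal {a. 1 \<le> weight_on A a}"
    show "f \<in> ideal_gen (var ` A)"
    proof (rule in_ideal_monomialsI[OF is_ideal_ideal_gen])
      fix a assume "a \<in> keys f"
      then have "1 \<le> weight_on A a" using f by (auto simp: mon_ideal_def)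
      then obtain v where v: "v \<in> A" "lookup a v > 0"
        unfolding weight_on_def by (metis not_gr_zero not_one_le_zero sum.neutral)
      have "a = (a - single v 1) + single v 1"
        using v by (intro poly_mapping_eqI) (auto simp: lookup_add lookup_minus lookup_single when_def)
      then have "single a 1 = single (a - single v 1) (1::'k) * var v"
        by (simp add: var_def mult_single)
      moreover have "var v \<in> (ideal_gen (var ` A) :: ('v, 'k) mpoly set)"
        using ideal_gen_superset v by blast
      ultimately show "single a (1::'k) \<in> ideal_gen (var ` A)"
        using is_ideal_ideal_gen unfolding is_ideal_def by metis
    qed
  qed
qed

lemma ideal_gen_var_inj:
  fixes A B :: "'v::finite set"
  assumes "ideal_gen (var ` A) = (ideal_gen (var ` B) :: ('v, 'k::field) mpoly set)"
  shows "A = B"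
proof -
  have "var v \<in> (ideal_gen (var ` A) :: ('v, 'k) mpoly set) \<longleftrightarrow> v \<in> A" for v and A :: "'v set"
    unfolding ideal_gen_var by (simp add: var_def weight_on_def lookup_single when_def)
  then show ?thesis using assms by blast
qed

text \<open>The value \<open>UNIV\<close> at 0 mirrors \<open>ideal_pow I 0 = UNIV\<close>: whatever
  an exponent has beyond a sum of \<open>m\<close> elements of \<open>U\<close> is absorbed
  there.\<close>

fun exponent_pow :: "('v \<Rightarrow>\<^sub>0 nat) set \<Rightarrow> nat \<Rightarrow> ('v \<Rightarrow>\<^sub>0 nat) set" where
  "exponent_pow U 0 = UNIV"
| "exponent_pow U (Suc m) = {a + b | a b. a \<in> exponent_pow U m \<and> b \<in> U}"

lemma upclosed_sumset:
  assumes "upclosed U"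
  shows "upclosed {a + b | a b. a \<in> U \<and> b \<in> V}"
proof -
  have "c + (a + b) \<in> {a + b | a b. a \<in> U \<and> b \<in> V}" if "a \<in> U" "b \<in> V" for a b c
  proof -
    have "c + (a + b) = (c + a) + b" by (simp add: add.assoc)
    then show ?thesis using assms that unfolding upclosed_def by blast
  qed
  then show ?thesis unfolding upclosed_def by blast
qed

lemma upclosed_exponent_pow: "upclosed (exponent_pow U m)"
proof (induction m)
  case 0 then show ?case by (simp add: upclosed_def)
next
  case (Suc m) then show ?case using upclosed_sumset by simp
qed

lemma ideal_prod_mon_ideal:
  assumes "upclosed U"
  shows "ideal_prod (mon_ideal U) (mon_ideal V)
    = (mon_ideal {a + b | a b. a \<in> U \<and> b \<in> V} :: ('v, 'k::field) mpoly set)"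
    (is "_ = mon_ideal ?W")
proof
  show "ideal_prod (mon_ideal U) (mon_ideal V) \<subseteq> (mon_ideal ?W :: ('v, 'k) mpoly set)"
    unfolding ideal_prod_def
  proof (rule ideal_gen_least[OF is_ideal_mon_ideal[OF upclosed_sumset[OF assms]]])
    have "f * g \<in> mon_ideal ?W" if "f \<in> mon_ideal U" "g \<in> mon_ideal V" for f g :: "('v, 'k) mpoly"
      using that keys_mult[of f g] unfolding mon_ideal_def by blast
    then show "{a * b |a b. a \<in> mon_ideal U \<and> b \<in> mon_ideal V} \<subseteq> (mon_ideal ?W :: ('v, 'k) mpoly set)"
      by blast
  qed
next
  show "(mon_ideal ?W :: ('v, 'k) mpoly set) \<subseteq> ideal_prod (mon_ideal U) (mon_ideal V)"
  proof
    fix f :: "('v, 'k) mpoly" assume f: "f \<in> mon_ideal ?W"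
    show "f \<in> ideal_prod (mon_ideal U) (mon_ideal V)"
      unfolding ideal_prod_def
    proof (rule in_ideal_monomialsI[OF is_ideal_ideal_gen])
      fix c assume "c \<in> keys f"
      then obtain a b where ab: "c = a + b" "a \<in> U" "b \<in> V"
        using f by (auto simp: mon_ideal_def)
      then have "single c 1 = single a (1::'k) * single b 1" by (simp add: mult_single)
      moreover have "single a (1::'k) \<in> mon_ideal U" "single b (1::'k) \<in> mon_ideal V"
        using ab by simp_all
      ultimately have "single c (1::'k) \<in> {a * b |a b. a \<in> mon_ideal U \<and> b \<in> mon_ideal V}"
        by blast
      then show "single c (1::'k) \<in> ideal_gen {a * b |a b. a \<in> mon_ideal U \<and> b \<in> mon_ideal V}"
        by (rule subsetD[OF ideal_gen_superset])
    qed
  qed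
qed

lemma ideal_pow_mon_ideal:
  "ideal_pow (mon_ideal U :: ('v, 'k::field) mpoly set) m = mon_ideal (exponent_pow U m)"
proof (induction m)
  case 0 then show ?case by (simp add: mon_ideal_def)
next
  case (Suc m) then show ?case by (simp only: ideal_pow.simps exponent_pow.simps
    ideal_prod_mon_ideal[OF upclosed_exponent_pow])
qed

text \<open>Provides a linear order on exponents that is compatible with addition: the variables are
  numbered and the order is pulled back from exponents over \<open>nat\<close>.\<close>

lemma ex_additive_linear_embedding:
  "\<exists>h :: ('v::finite \<Rightarrow>\<^sub>0 nat) \<Rightarrow> (nat \<Rightarrow>\<^sub>0 nat). inj h \<and> (\<forall>a b. h (a + b) = h a + h b)"
proof -
  obtain e :: "'v \<Rightarrow> nat" where e: "inj e"
    using finite_imp_inj_to_nat_seg[of "UNIV :: 'v set"] by auto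
  define h where "h = (\<lambda>a :: 'v \<Rightarrow>\<^sub>0 nat. \<Sum>v\<in>UNIV. single (e v) (lookup a v))"
  have "lookup (h a) (e v) = lookup a v" for a v
    by (simp add: h_def lookup_sum lookup_single when_def inj_eq[OF e])
  then have "inj h" by (intro injI poly_mapping_eqI) metis
  moreover have "h (a + b) = h a + h b" for a b
    by (simp add: h_def lookup_add single_add sum.distrib)
  ultimately show ?thesis by blast
qed

text \<open>All summands of the convolution vanish except possibly the one for \<open>a\<close> and
  \<open>b\<close>. As these may lie outside the supports, the formula also detects zero
  coefficients.\<close>

lemma lookup_mult_unique_pair:
  fixes f g :: "('v, 'k::field) mpoly"
  assumes "\<And>a' b'. a' \<in> keys f \<Longrightarrow> b' \<in> keys g \<Longrightarrow> a + b = a' + b' \<Longrightarrow> a' = a \<and> b' = b"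
  shows "lookup (f * g) (a + b) = lookup f a * lookup g b"
proof -
  have "(\<Sum>q. lookup g q when a + b = l + q) * lookup f l = (lookup f a * lookup g b when l = a)" for l
  proof (cases "lookup f l = 0")
    case True then show ?thesis by (auto simp: when_def)
  next
    case False
    have "(\<lambda>q. lookup g q when a + b = l + q) = (\<lambda>q. (lookup g q when l = a) when q = b)"
      using assms[of l] False by (auto simp: fun_eq_iff when_def in_keys_iff)
    then have "(\<Sum>q. lookup g q when a + b = l + q) = (lookup g b when l = a)"
      by (simp only: Sum_any_when_equal)
    then show ?thesis by (simp add: when_def)
  qed
  then show ?thesis unfolding lookup_mult by (simp add: mult.commute)
qed

text \<open>The product of the lowest terms, with respect to the \<open>A\<close>-degree refined by a linear order on
  exponents, survives in \<open>g * f\<close>.\<close>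
lemma weight_ideal_primary:
  fixes f g :: "('v::finite, 'k::field) mpoly"
  assumes gf: "g * f \<in> mon_ideal {a. t \<le> weight_on A a}"
    and f: "f \<notin> mon_ideal {a. t \<le> weight_on A a}"
  shows "g \<in> mon_ideal {a. 1 \<le> weight_on A a}"
proof (rule ccontr)
  assume g: "g \<notin> mon_ideal {a. 1 \<le> weight_on A a}"
  obtain h :: "('v \<Rightarrow>\<^sub>0 nat) \<Rightarrow> (nat \<Rightarrow>\<^sub>0 nat)" where h: "inj h" "\<And>a b. h (a + b) = h a + h b"
    using ex_additive_linear_embedding by blast
  obtain a0 where a0: "a0 \<in> keys f" "weight_on A a0 < t" 
    using f unfolding mon_ideal_def by fastforce
  define d where "d = Min (weight_on A ` keys f)"
  have d_le: "d \<le> weight_on A a" if "a \<in> keys f" for a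
    using that by (simp add: d_def)
  have "d < t" using d_le[OF a0(1)] a0(2) by simp
  \<comment> \<open>\<open>X\<close> is the part of \<open>f\<close> of lowest
    \<open>A\<close>-degree and \<open>Y\<close> the part of \<open>g\<close> of
    \<open>A\<close>-degree 0, nonempty because \<open>g\<close> is outside the prime.\<close>
  define X where "X = {a \<in> keys f. weight_on A a = d}"
  define Y where "Y = {b \<in> keys g. weight_on A b = 0}"
  have "d \<in> weight_on A ` keys f" unfolding d_def using a0 by (intro Min_in) auto
  then have "X \<noteq> {}" "finite X" unfolding X_def by auto
  moreover have "Y \<noteq> {}" "finite Y" using g by (auto simp: Y_def mon_ideal_def not_less_eq_eq)
  ultimately obtain a b where "is_arg_min h (\<lambda>a. a \<in> X) a" "is_arg_min h (\<lambda>b. b \<in> Y) b"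
    using ex_is_arg_min_if_finite by metis
  then have a: "a \<in> X" "\<And>a'. a' \<in> X \<Longrightarrow> h a \<le> h a'"
    and b: "b \<in> Y" "\<And>b'. b' \<in> Y \<Longrightarrow> h b \<le> h b'"
    by (auto simp: is_arg_min_linorder)
  have "a' = b \<and> b' = a" if "a' \<in> keys g" "b' \<in> keys f" "b + a = a' + b'" for a' b'
  proof -
    have "weight_on A b + weight_on A a = weight_on A a' + weight_on A b'"
      using that(3) by (metis weight_on_add)
    moreover have "d \<le> weight_on A b'" using d_le that by blast
    ultimately have "a' \<in> Y" "b' \<in> X" using a(1) b(1) that by (auto simp: X_def Y_def)
    then have le: "h b \<le> h a'" "h a \<le> h b'" using a b by auto
    have eq: "h b + h a = h a' + h b'" using that(3) h(2) by metis
    have "h b = h a'"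
      using le eq by (metis add_le_cancel_right add_left_mono antisym)
    then show ?thesis using eq h(1) by (auto simp: inj_eq)
  qed
  then have "lookup (g * f) (b + a) = lookup g b * lookup f a"
    by (rule lookup_mult_unique_pair)
  then have "b + a \<in> keys (g * f)"
    using a(1) b(1) by (auto simp: X_def Y_def in_keys_iff)
  then have "t \<le> weight_on A (b + a)" using gf by (auto simp: mon_ideal_def)
  then show False using a(1) b(1) \<open>d < t\<close> by (auto simp: X_def Y_def weight_on_add)
qed

section \<open>Associated primes of monomial ideals\<close>

lemma prime_ideal_ideal_gen_var:
  "prime_ideal (ideal_gen (var ` A) :: ('v::finite, 'k::field) mpoly set)"
  unfolding prime_ideal_def
proof (intro conjI allI impI)
  have "1 \<notin> (ideal_gen (var ` A) :: ('v, 'k) mpoly set)"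
    by (simp add: ideal_gen_var mon_ideal_def weight_on_def)
  then show "(ideal_gen (var ` A) :: ('v, 'k) mpoly set) \<noteq> UNIV" by blast
next
  fix g f :: "('v, 'k) mpoly" assume "g * f \<in> ideal_gen (var ` A)"
  then show "g \<in> ideal_gen (var ` A) \<or> f \<in> ideal_gen (var ` A)"
    unfolding ideal_gen_var using weight_ideal_primary by blast
qed (rule is_ideal_ideal_gen)

lemma single_mult_in_mon_ideal_iff:
  fixes g :: "('v, 'k::field) mpoly"
  shows "g * single a 1 \<in> mon_ideal U \<longleftrightarrow> g \<in> mon_ideal {b. b + a \<in> U}"
proof -
  have "lookup (g * single a 1) (b + a) = lookup g b" for b
    by (subst lookup_mult_unique_pair) (auto simp: lookup_single)
  then have "keys (g * single a 1) = (\<lambda>b. b + a) ` keys g"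
    using keys_mult[of g "single a 1"] by (auto simp: in_keys_iff split: if_splits)
  then show ?thesis by (auto simp: mon_ideal_def)
qed

text \<open>Both families of associated primes below are exhibited by this criterion: the prime is
  the annihilator of the class of the monomial with exponent \<open>a\<close>.\<close>

lemma ideal_gen_var_in_Ass:
  fixes A :: "'v::finite set"
  assumes "\<And>b. b + a \<in> U \<longleftrightarrow> 1 \<le> weight_on A b"
  shows "ideal_gen (var ` A) \<in> Ass (mon_ideal U :: ('v, 'k::field) mpoly set)"
proof -
  have "ideal_gen (var ` A) = colon (mon_ideal U :: ('v, 'k) mpoly set) (single a 1)"
    unfolding ideal_gen_var colon_def single_mult_in_mon_ideal_iff assms by simp
  then show ?thesis unfolding Ass_def using prime_ideal_ideal_gen_var by blast
qed

lemma prime_ideal_prod_in: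
  assumes "prime_ideal P" "finite X" "(\<Prod>x\<in>X. f x) \<in> P"
  shows "\<exists>x\<in>X. f x \<in> P"
  using assms(2,3)
proof (induction X rule: finite_induct)
  case empty
  then have "r * 1 \<in> P" for r
    using assms(1) unfolding prime_ideal_def is_ideal_def prod.empty by blast
  then show ?case using assms(1) by (auto simp: prime_ideal_def)
next
  case (insert x X)
  then show ?case using assms(1) by (auto simp: prime_ideal_def)
qed

lemma prime_ideal_power_in:
  assumes "prime_ideal P" "x ^ n \<in> P"
  shows "x \<in> P"
  using prime_ideal_prod_in[OF assms(1), of "{..<n}" "\<lambda>_. x"] assms(2) by auto

text \<open>With \<open>Q A\<close> cut out by the single condition at \<open>A\<close>, an
  associated prime is a finite intersection of the colons of the \<open>Q A\<close> by
  \<open>f\<close>, hence equals one of them. Primariness of \<open>Q A\<close> bounds it above by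
  the prime of \<open>A\<close>; powers of the variables in \<open>A\<close> bound it below.\<close>

lemma Ass_weight_ideal_subset:
  fixes t :: "'v::finite set \<Rightarrow> nat"
  shows "Ass (mon_ideal {a. \<forall>A\<in>\<A>. t A \<le> weight_on A a} :: ('v, 'k::field) mpoly set)
    \<subseteq> (\<lambda>A. ideal_gen (var ` A)) ` \<A>"
proof
  fix P assume "P \<in> Ass (mon_ideal {a. \<forall>A\<in>\<A>. t A \<le> weight_on A a} :: ('v, 'k) mpoly set)"
  then obtain f where P: "prime_ideal P"
    and Pf: "P = colon (mon_ideal {a. \<forall>A\<in>\<A>. t A \<le> weight_on A a} :: ('v, 'k) mpoly set) f"
    unfolding Ass_def by blast
  define Q where "Q A = (mon_ideal {a. t A \<le> weight_on A a} :: ('v, 'k) mpoly set)" for A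
  have idQ: "is_ideal (Q A)" for A unfolding Q_def by (rule is_ideal_mon_ideal[OF upclosed_weight_ge])
  have Pf': "P = {g. \<forall>A\<in>\<A>. g * f \<in> Q A}"
    unfolding Pf colon_def Q_def mon_ideal_def by auto
  have "\<exists>A\<in>\<A>. \<forall>g. g * f \<in> Q A \<longrightarrow> g \<in> P"
  proof (rule ccontr)
    assume "\<not> ?thesis"
    \<comment> \<open>One multiplier outside \<open>P\<close> for each \<open>A\<close>; their
      product multiplies \<open>f\<close> into every \<open>Q A\<close> at once.\<close>
    then obtain g where g: "\<And>A. A \<in> \<A> \<Longrightarrow> g A * f \<in> Q A" "\<And>A. A \<in> \<A> \<Longrightarrow> g A \<notin> P" by metis
    have "(\<Prod>B\<in>\<A>. g B) * f \<in> Q A" if "A \<in> \<A>" for A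
    proof -
      have "(\<Prod>B\<in>\<A>. g B) * f = (\<Prod>B\<in>\<A>-{A}. g B) * (g A * f)"
        using that by (simp add: prod.remove[of \<A> A] mult_ac)
      then show ?thesis using idQ g(1)[OF that] unfolding is_ideal_def by metis
    qed
    then have "(\<Prod>B\<in>\<A>. g B) \<in> P" unfolding Pf' by blast
    then show False using prime_ideal_prod_in[OF P, of \<A> g] g(2) by auto
  qed
  then obtain A where A: "A \<in> \<A>" "\<And>g. g * f \<in> Q A \<longleftrightarrow> g \<in> P" using Pf' by blast
  have fQ: "f \<notin> Q A"
  proof
    assume "f \<in> Q A"
    then have "P = UNIV" using A(2) idQ unfolding is_ideal_def by blast
    then show False using P by (simp add: prime_ideal_def)
  qed
  have "P \<subseteq> ideal_gen (var ` A)"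
    using A(2) fQ unfolding ideal_gen_var Q_def using weight_ideal_primary by blast
  moreover have "ideal_gen (var ` A) \<subseteq> P"
  proof (rule ideal_gen_least)
    show "is_ideal P" using P by (simp add: prime_ideal_def)
    have "var v \<in> P" if "v \<in> A" for v
    proof -
      have "(var v :: ('v, 'k) mpoly) ^ n = single (single v n) 1" for n
        by (induction n) (simp_all add: var_def mult_single single_add[symmetric])
      moreover have "t A \<le> weight_on A (single v (t A))"
        using that by (simp add: weight_on_def lookup_single when_def)
      ultimately have "var v ^ t A \<in> Q A" by (simp add: Q_def)
      then have "f * var v ^ t A \<in> Q A" using idQ unfolding is_ideal_def by blast
      then have "var v ^ t A \<in> P" using A(2) by (metis mult.commute)
      then show ?thesis using prime_ideal_power_in[OF P] by blast
    qed
    then show "var ` A \<subseteq> P" by blast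
  qed
  ultimately show "P \<in> (\<lambda>A. ideal_gen (var ` A)) ` \<A>" using A(1) by blast
qed

section \<open>Odd closed walks\<close>

text \<open>The walk is an infinite sequence of period \<open>k\<close>, so that indices need no
  reduction and every shift is again a closed walk. Vertices may repeat.\<close>

definition closed_walk :: "('v \<Rightarrow> 'v \<Rightarrow> bool) \<Rightarrow> (nat \<Rightarrow> 'v) \<Rightarrow> nat \<Rightarrow> bool" where
  "closed_walk E F k \<longleftrightarrow> (\<forall>i. E (F i) (F (Suc i))) \<and> (\<forall>i. F (i + k) = F i)"

lemma closed_walk_mod:
  assumes "closed_walk E F k"
  shows "F (i mod k) = F i"
proof -
  have "F (j + n * k) = F j" for j n
  proof (induction n)
    case (Suc n)
    have "j + Suc n * k = (j + n * k) + k" by simp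
    with Suc assms show ?case unfolding closed_walk_def by metis
  qed simp
  then show ?thesis by (metis mod_div_mult_eq)
qed

lemma closed_walkI_cyclic:
  assumes "k > 0" "\<And>i. Suc i < k \<Longrightarrow> E (f i) (f (Suc i))" "E (f (k - 1)) (f 0)"
  shows "closed_walk E (\<lambda>i. f (i mod k)) k"
  unfolding closed_walk_def
proof (intro conjI allI)
  fix i show "E (f (i mod k)) (f (Suc i mod k))"
  proof (cases "Suc (i mod k) = k")
    case True
    then have "Suc i mod k = 0" "i mod k = k - 1" by (auto simp: mod_Suc)
    then show ?thesis using assms(3) by simp
  next
    case False
    then have "Suc i mod k = Suc (i mod k)" by (simp add: mod_Suc)
    moreover have "Suc (i mod k) < k" using False assms(1) by (simp add: Suc_lessI)
    ultimately show ?thesis using assms(2) by simp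
  qed
qed simp

lemma sum_walk_pairs_le:
  fixes w :: "'v \<Rightarrow> nat"
  assumes "\<And>i. E (F i) (F (Suc i))" "\<And>u u'. E u u' \<Longrightarrow> w u + w u' \<le> m"
  shows "(\<Sum>i<2 * n. w (F (s + i))) \<le> m * n"
proof (induction n)
  case (Suc n)
  have "w (F (s + 2 * n)) + w (F (s + Suc (2 * n))) \<le> m" using assms by simp
  with Suc show ?case by simp
qed simp

lemma sum_closed_walk_shift:
  fixes w :: "'v \<Rightarrow> nat"
  assumes "closed_walk E F k"
  shows "(\<Sum>i<k. w (F (s + i))) = (\<Sum>i<k. w (F i))"
proof (induction s)
  case (Suc s)
  have "w (F s) + (\<Sum>i<k. w (F (Suc s + i))) = (\<Sum>i<Suc k. w (F (s + i)))"
    by (subst sum.lessThan_Suc_shift) simp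
  also have "\<dots> = (\<Sum>i<k. w (F (s + i))) + w (F s)"
    using assms by (simp add: closed_walk_def)
  finally show ?case using Suc by simp
qed simp

text \<open>An edge excluded by \<open>no\<close> would close \<open>d + 1\<close> consecutive
  vertices to a shorter odd closed walk. As \<open>k\<close> is odd, exactly one of the two arcs
  between two positions has even length, so testing even \<open>d\<close> catches every chord and
  also every repeated vertex.\<close>

lemma chordless_odd_closed_walk_induced:
  assumes G: "simple_graph E" and F: "closed_walk E F k" and k: "odd k"
    and no: "\<And>i d. even d \<Longrightarrow> Suc d < k \<Longrightarrow> \<not> E (F (i + d)) (F i)"
  shows "induced_odd_cycle E (F ` {..<k})" "inj_on F {..<k}"
proof -
  have sym: "E u v \<Longrightarrow> E v u" and irr: "\<not> E u u" for u v
    using G by (auto simp: simple_graph_def)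
  have E: "E (F i) (F (Suc i))" and per: "F (i + k) = F i" for i
    using F by (auto simp: closed_walk_def)
  have k3: "k \<ge> 3"
  proof (rule ccontr)
    assume "\<not> k \<ge> 3"
    then have "k = 1" using k by (auto simp: not_le less_Suc_eq numeral_3_eq_3)
    then show False using E[of 0] per[of 0] irr by simp
  qed
  have neq: "F i \<noteq> F j" if "i < j" "j < k" for i j
  proof
    assume eq: "F i = F j"
    \<comment> \<open>One step along the walk, from \<open>j\<close> if \<open>j - i\<close> is even
      and from \<open>i\<close> otherwise, leads from the repeated vertex along an edge that
      \<open>no\<close> excludes.\<close>
    show False
    proof (cases "even (j - i)")
      case True
      define d where "d = i + k - Suc j"
      have d: "Suc j + d = i + k" using that by (simp add: d_def)
      have "even d" using True that k unfolding d_def by (cases "even i") auto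
      then have "\<not> E (F (i + k)) (F (Suc j))"
        using that no[of d "Suc j"] unfolding d by (auto simp: d_def)
      then show False using per E[of j] eq by simp
    next
      case False
      then have "\<not> E (F (Suc i + (j - Suc i))) (F (Suc i))"
        using that by (intro no) auto
      then show False using that eq E[of i] by simp
    qed
  qed
  have adj: "j = Suc i \<or> (i = 0 \<and> Suc j = k)" if "E (F i) (F j)" "i < j" "j < k" for i j
  proof (cases "even (j - i)")
    case True
    then have "\<not> Suc (j - i) < k" using no[of "j - i" i] sym that by auto
    then show ?thesis using that by linarith
  next
    case False
    then have "even (i + k - j)" using that k by (cases "even i") auto
    then have "\<not> Suc (i + k - j) < k" using no[of "i + k - j" j] that per[of i] by auto
    then show ?thesis using that by linarith
  qed
  show inj: "inj_on F {..<k}"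
    by (rule inj_onI) (metis lessThan_iff neq nat_neq_iff)
  have "E (F i) (F j) \<longleftrightarrow> j = Suc i mod k \<or> i = Suc j mod k" if "i < k" "j < k" for i j
  proof
    assume "j = Suc i mod k \<or> i = Suc j mod k"
    then show "E (F i) (F j)" using closed_walk_mod[OF F] E sym by metis
  next
    assume ij: "E (F i) (F j)"
    consider "i < j" | "j < i" using ij irr by (metis nat_neq_iff)
    then show "j = Suc i mod k \<or> i = Suc j mod k"
    proof cases
      case 1 then show ?thesis using adj[OF ij 1 that(2)] that by auto
    next
      case 2 then show ?thesis using adj[OF sym[OF ij] 2 that(1)] that by auto
    qed
  qed
  then show "induced_odd_cycle E (F ` {..<k})"
    unfolding induced_odd_cycle_def using k k3 inj inj_on_imp_bij_betw by blast
qed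

text \<open>A chord splits an odd closed walk into a shorter odd closed walk and a path on an even number of
  vertices; the latter is covered by disjoint edges.\<close>
lemma odd_closed_walk_contains_induced_odd_cycle:
  assumes G: "simple_graph E" and "closed_walk E F k" and "odd k"
  shows "\<exists>S. induced_odd_cycle E S \<and> S \<subseteq> range F \<and> card S \<le> k \<and>
    (\<forall>(w :: 'v \<Rightarrow> nat) m. (\<forall>u v. E u v \<longrightarrow> w u + w v \<le> m) \<longrightarrow>
      (\<Sum>i<k. w (F i)) \<le> sum w S + m * ((k - card S) div 2))"
  using assms(2,3)
proof (induction k arbitrary: F rule: less_induct)
  case (less k)
  show ?case
  proof (cases "\<exists>i d. even d \<and> Suc d < k \<and> E (F (i + d)) (F i)")
    case False
    then have ind: "induced_odd_cycle E (F ` {..<k})" "inj_on F {..<k}"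
      using chordless_odd_closed_walk_induced[OF G less.prems] by blast+
    have "card (F ` {..<k}) = k" using ind(2) by (simp add: card_image)
    then show ?thesis using ind less.prems
      by (intro exI[of _ "F ` {..<k}"]) (auto simp: sum.reindex)
  next
    case True
    then obtain s d where d: "even d" "Suc d < k" "E (F (s + d)) (F s)" by blast
    have E: "\<And>i. E (F i) (F (Suc i))" using less.prems by (auto simp: closed_walk_def)
    define f where "f i = F (s + i)" for i
    \<comment> \<open>The chord from \<open>f d\<close> back to \<open>f 0\<close> closes the first
      \<open>Suc d\<close> vertices; the other \<open>k - Suc d\<close>, an even number, remain as a
      path.\<close>
    have "closed_walk E (\<lambda>i. f (i mod Suc d)) (Suc d)"
      by (rule closed_walkI_cyclic) (use d E in \<open>auto simp: f_def\<close>)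
    from less.IH[OF d(2) this] d(1) obtain S where S: "induced_odd_cycle E S"
      "S \<subseteq> range (\<lambda>i. f (i mod Suc d))" "card S \<le> Suc d"
      and Sw: "\<And>(w :: 'v \<Rightarrow> nat) m. (\<forall>u v. E u v \<longrightarrow> w u + w v \<le> m) \<Longrightarrow>
        (\<Sum>i<Suc d. w (f (i mod Suc d))) \<le> sum w S + m * ((Suc d - card S) div 2)"
      by auto
    have "(\<Sum>i<k. w (F i)) \<le> sum w S + m * ((k - card S) div 2)"
      if w: "\<forall>u v. E u v \<longrightarrow> w u + w v \<le> m" for w :: "'v \<Rightarrow> nat" and m
    proof -
      define n where "n = (k - Suc d) div 2"
      have k: "k = Suc d + 2 * n" using d less.prems by (auto simp: n_def)
      have "(\<Sum>i<k. w (F i)) = (\<Sum>i<k. w (F (s + i)))"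
        using sum_closed_walk_shift[OF less.prems(1)] by metis
      also have "\<dots> = (\<Sum>i<Suc d. w (F (s + i))) + (\<Sum>i<2 * n. w (F ((s + Suc d) + i)))"
        unfolding k lessThan_atLeast0
        by (subst sum.atLeastLessThan_concat[symmetric, of 0 "Suc d"], simp, simp)
           (use sum.shift_bounds_nat_ivl[of "\<lambda>i. w (F (s + i))" 0 "Suc d" "2 * n"] in
              \<open>simp add: add_ac\<close>)
      also have "(\<Sum>i<2 * n. w (F ((s + Suc d) + i))) \<le> m * n"
        using sum_walk_pairs_le[of E F w m] E w by blast
      also have "(\<Sum>i<Suc d. w (F (s + i))) = (\<Sum>i<Suc d. w (f (i mod Suc d)))"
        by (intro sum.cong) (auto simp: f_def)
      also have "\<dots> \<le> sum w S + m * ((Suc d - card S) div 2)" using Sw[OF w] .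
      also have "sum w S + m * ((Suc d - card S) div 2) + m * n
        = sum w S + m * ((Suc d - card S) div 2 + n)" by (simp add: distrib_left)
      \<comment> \<open>Subtraction is truncated, so moving \<open>2 * n\<close> inside needs
        \<open>card S \<le> Suc d\<close>, which the induction carries along.\<close>
      also have "(Suc d - card S) div 2 + n = (k - card S) div 2"
        using S(3) unfolding k by simp
      finally show ?thesis by simp
    qed
    moreover have "S \<subseteq> range F" using S(2) by (auto simp: f_def)
    ultimately show ?thesis using S d(2) by (intro exI[of _ S]) auto
  qed
qed

section \<open>Odd closed walks and bipartiteness\<close>

lemma relpowp_odd_closed_walk:
  assumes "(E ^^ k) u u" "odd k"
  shows "\<exists>F. closed_walk E F k"
proof -
  obtain f where f: "f 0 = u" "f k = u" "\<forall>i<k. E (f i) (f (Suc i))"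
    using assms by (auto simp: relpowp_fun_conv)
  have "k > 0" using assms(2) by (auto elim: oddE)
  have "closed_walk E (\<lambda>i. f (i mod k)) k"
  proof (rule closed_walkI_cyclic)
    show "E (f (k - 1)) (f 0)" using f \<open>k > 0\<close> by (metis Suc_pred' diff_less zero_less_one)
  qed (use f \<open>k > 0\<close> in auto)
  then show ?thesis by blast
qed

lemma relpowp_sym:
  assumes "\<And>u v. E u v \<Longrightarrow> E v u" "(E ^^ n) u v"
  shows "(E ^^ n) v u"
  using assms(2)
proof (induction n arbitrary: v)
  case (Suc n)
  then obtain z where "(E ^^ n) u z" "E z v" by auto
  then show ?case using Suc.IH assms(1) by (metis relpowp_Suc_I2)
qed simp

lemma relpowp_add_I: "(E ^^ m) u v \<Longrightarrow> (E ^^ n) v x \<Longrightarrow> (E ^^ (m + n)) u x"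
  by (auto simp: relpowp_add)

text \<open>Without odd closed walks, the parity of walks from a root is a proper colouring. A root
  is chosen in each component, because the lemma is later applied to a graph in which a vertex has
  been isolated.\<close>

lemma not_bipartite_odd_closed_walk:
  assumes sym: "\<And>u v. E u v \<Longrightarrow> E v u" and nb: "\<not> bipartite E"
  shows "\<exists>F k. odd k \<and> closed_walk E F k"
proof (rule ccontr)
  assume "\<not> ?thesis"
  then have no: "\<not> (E ^^ k) u u" if "odd k" for k u
    using that relpowp_odd_closed_walk[of k E u] by auto
  define r where "r u = (SOME z. E\<^sup>*\<^sup>* z u)" for u
  have r: "E\<^sup>*\<^sup>* (r u) u" for u unfolding r_def by (rule someI[of _ u]) simp
  have r_eq: "r u = r v" if "E u v" for u v
  proof -
    have "E\<^sup>*\<^sup>* z u \<longleftrightarrow> E\<^sup>*\<^sup>* z v" for z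
      using that sym by (meson rtranclp.rtrancl_into_rtrancl)
    then show ?thesis unfolding r_def by simp
  qed
  define c where "c u = (\<exists>n. even n \<and> (E ^^ n) (r u) u)" for u
  have "c u \<noteq> c v" if uv: "E u v" for u v
  proof
    assume eq: "c u = c v"
    show False
    proof (cases "c u")
      case True
      then obtain n n' where n: "even n" "(E ^^ n) (r u) u" "even n'" "(E ^^ n') (r u) v"
        using eq r_eq[OF uv] unfolding c_def by auto
      have "(E ^^ Suc n) (r u) v" using n(2) uv by auto
      then have "(E ^^ (Suc n + n')) (r u) (r u)"
        using relpowp_add_I[OF _ relpowp_sym[OF sym n(4)]] by blast
      then show False using no[of "Suc n + n'"] n by simp
    next
      case False
      obtain n where n: "(E ^^ n) (r u) u" using r[of u] by (auto simp: rtranclp_power)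
      then have "odd n" using False unfolding c_def by blast
      moreover have "(E ^^ Suc n) (r v) v" using n uv r_eq[OF uv] by auto
      ultimately have "c v" unfolding c_def by (metis even_Suc)
      then show False using False eq by simp
    qed
  qed
  then show False using nb unfolding bipartite_def by blast
qed

lemma not_bipartite_induced_odd_cycle:
  assumes "simple_graph E" "\<not> bipartite E"
  shows "\<exists>S. induced_odd_cycle E S"
proof -
  obtain F k where "odd k" "closed_walk E F k"
    using not_bipartite_odd_closed_walk[of E] assms unfolding simple_graph_def by blast
  then show ?thesis using odd_closed_walk_contains_induced_odd_cycle[OF assms(1)] by blast
qed

text \<open>An odd closed walk avoiding \<open>v\<close> would contain an induced odd cycle avoiding
  \<open>v\<close>. It is induced in \<open>E\<close> too, since deleting \<open>v\<close> removes
  no edge between other vertices.\<close>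

lemma bipartite_delete_vertex:
  assumes G: "simple_graph E"
    and uniq: "\<And>S'. induced_odd_cycle E S' \<Longrightarrow> S' = S" and v: "v \<in> S"
  shows "bipartite (\<lambda>u u'. E u u' \<and> u \<noteq> v \<and> u' \<noteq> v)" (is "bipartite ?E")
proof (rule ccontr)
  assume nb: "\<not> bipartite ?E"
  have G': "simple_graph ?E" using G by (auto simp: simple_graph_def)
  then obtain F k where F: "odd k" "closed_walk ?E F k"
    using not_bipartite_odd_closed_walk[of ?E] nb unfolding simple_graph_def by blast
  obtain T where T: "induced_odd_cycle ?E T" "T \<subseteq> range F"
    using odd_closed_walk_contains_induced_odd_cycle[OF G' F(2,1)] by blast
  have "v \<notin> range F" using F(2) by (auto simp: closed_walk_def)
  then have vT: "v \<notin> T" using T by blast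
  obtain k' f where f: "odd k'" "k' \<ge> 3" "bij_betw f {..<k'} T"
    "\<forall>i<k'. \<forall>j<k'. ?E (f i) (f j) \<longleftrightarrow> (j = Suc i mod k' \<or> i = Suc j mod k')"
    using T(1) unfolding induced_odd_cycle_def by blast
  have "f i \<noteq> v" if "i < k'" for i using f(3) vT that by (auto simp: bij_betw_def)
  then have "induced_odd_cycle E T"
    unfolding induced_odd_cycle_def using f by (intro exI[of _ k'] exI[of _ f]) auto
  then show False using uniq v vT by blast
qed

section \<open>Decomposing weights into independent sets\<close>

definition independent :: "('v \<Rightarrow> 'v \<Rightarrow> bool) \<Rightarrow> 'v set \<Rightarrow> bool" where
  "independent E T \<longleftrightarrow> (\<forall>u\<in>T. \<forall>v\<in>T. \<not> E u v)"

text \<open>The sets may repeat or be empty. Their complements are vertex covers, which is the link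
  to exponents in powers of the cover ideal.\<close>

definition decomposable :: "('v \<Rightarrow> 'v \<Rightarrow> bool) \<Rightarrow> nat \<Rightarrow> ('v \<Rightarrow> nat) \<Rightarrow> bool" where
  "decomposable E m w \<longleftrightarrow>
    (\<exists>T. (\<forall>i<m. independent E (T i)) \<and> (\<forall>u. w u = card {i. i < m \<and> u \<in> T i}))"

lemma decomposable_add:
  assumes "decomposable E m p" "decomposable E n q"
  shows "decomposable E (m + n) (\<lambda>u. p u + q u)"
proof -
  obtain T T' where T: "\<forall>i<m. independent E (T i)" "\<forall>u. p u = card {i. i < m \<and> u \<in> T i}"
    and T': "\<forall>i<n. independent E (T' i)" "\<forall>u. q u = card {i. i < n \<and> u \<in> T' i}"
    using assms unfolding decomposable_def by blast
  define R where "R i = (if i < m then T i else T' (i - m))" for i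
  have "p u + q u = card {i. i < m + n \<and> u \<in> R i}" for u
  proof -
    have "{i. i < m + n \<and> u \<in> R i} = {i. i < m \<and> u \<in> T i} \<union> (+) m ` {i. i < n \<and> u \<in> T' i}"
    proof (intro set_eqI iffI)
      fix i assume i: "i \<in> {i. i < m + n \<and> u \<in> R i}"
      show "i \<in> {i. i < m \<and> u \<in> T i} \<union> (+) m ` {i. i < n \<and> u \<in> T' i}"
      proof (cases "i < m")
        case False
        then have "i = m + (i - m)" "i - m < n" "u \<in> T' (i - m)" using i by (auto simp: R_def)
        then show ?thesis by blast
      qed (use i in \<open>auto simp: R_def\<close>)
    qed (auto simp: R_def)
    also have "card \<dots> = card {i. i < m \<and> u \<in> T i} + card ((+) m ` {i. i < n \<and> u \<in> T' i})"
      by (rule card_Un_disjoint) auto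
    finally show ?thesis using T T' by (simp add: card_image)
  qed
  moreover have "\<forall>i<m + n. independent E (R i)" using T(1) T'(1) by (auto simp: R_def)
  ultimately show ?thesis unfolding decomposable_def by blast
qed

text \<open>One colour class uses the colours from below, the other one from above.\<close>
lemma bipartite_decomposable:
  fixes w :: "'v \<Rightarrow> nat" and c :: "'v \<Rightarrow> bool"
  assumes c: "\<And>u v. E u v \<Longrightarrow> w u > 0 \<Longrightarrow> w v > 0 \<Longrightarrow> c u \<noteq> c v"
    and wm: "\<And>u. w u \<le> m" and wE: "\<And>u v. E u v \<Longrightarrow> w u + w v \<le> m"
  shows "decomposable E m w"
proof -
  define T where "T i = {u. if c u then i < w u else m - Suc i < w u}" for i
  have "independent E (T i)" if "i < m" for i
    unfolding independent_def
  proof (intro ballI notI)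
    fix u v assume "u \<in> T i" "v \<in> T i" "E u v"
    then show False using c[of u v] wE[of u v] that by (auto simp: T_def split: if_splits)
  qed
  moreover have "w u = card {i. i < m \<and> u \<in> T i}" for u
  proof (cases "c u")
    case True
    then have "{i. i < m \<and> u \<in> T i} = {..<w u}" using wm[of u] by (auto simp: T_def)
    then show ?thesis by simp
  next
    case False
    then have "{i. i < m \<and> u \<in> T i} = {m - w u..<m}" using wm[of u] by (auto simp: T_def)
    then show ?thesis using wm[of u] by simp
  qed
  ultimately show ?thesis unfolding decomposable_def by blast
qed

text \<open>Lower bounds that are forced, along walks starting at \<open>v\<close>, on the part of \<open>w\<close> that is
  covered by the \<open>w v\<close> independent sets containing \<open>v\<close>.\<close>
inductive forced_lower :: "('v \<Rightarrow> 'v \<Rightarrow> bool) \<Rightarrow> ('v \<Rightarrow> int) \<Rightarrow> int \<Rightarrow> 'v \<Rightarrow> 'v \<Rightarrow> int \<Rightarrow> bool"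
  for E w m v where
  zero: "x \<noteq> v \<Longrightarrow> forced_lower E w m v x 0"
| vertex: "x \<noteq> v \<Longrightarrow> forced_lower E w m v x (w x + w v - m)"
| nbr: "E v y \<Longrightarrow> E y x \<Longrightarrow> x \<noteq> v \<Longrightarrow> forced_lower E w m v x (w x + w y + w v - m)"
| step: "forced_lower E w m v z b \<Longrightarrow> E z y \<Longrightarrow> y \<noteq> v \<Longrightarrow> E y x \<Longrightarrow> x \<noteq> v
    \<Longrightarrow> forced_lower E w m v x (b + w x + w y - m)"

text \<open>The rules say what \<open>p\<close> must satisfy if \<open>p v = w v\<close>, if
  \<open>p\<close> is at most \<open>w v\<close> on vertices and edges, and if \<open>w - p\<close>
  is at most \<open>m - w v\<close> there: a neighbour \<open>y\<close> of \<open>v\<close> has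
  \<open>p y = 0\<close>, and \<open>p z \<ge> b\<close> forces \<open>p y \<le> w v - b\<close>
  along an edge \<open>z y\<close>. The walk in the last alternative records how a bound arose; each
  step adds two vertices and subtracts one \<open>m\<close>.\<close>

lemma forced_lower_bounds:
  fixes w :: "'v \<Rightarrow> int"
  assumes w0: "\<And>u. 0 \<le> w u" and wm: "\<And>u. w u \<le> m" and wE: "\<And>u u'. E u u' \<Longrightarrow> w u + w u' \<le> m"
    and "forced_lower E w m v x b"
  shows "b \<le> w v \<and> b \<le> w x \<and> (b \<le> 0 \<or> b \<le> w x + w v - m \<or>
    (\<exists>f h. f 0 = v \<and> f (2 * h) = x \<and> (\<forall>i<2 * h. E (f i) (f (Suc i))) \<and>
      b + m * int h \<le> (\<Sum>i<2 * h + 1. w (f i))))"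
  using assms(4)
proof (induction rule: forced_lower.induct)
  case (zero x)
  then show ?case using w0 by simp
next
  case (vertex x)
  then show ?case using wm[of x] wm[of v] by auto
next
  case (nbr y x)
  define f where "f i = (if i = 0 then v else if i = 1 then y else x)" for i :: nat
  have "\<exists>f h. f 0 = v \<and> f (2 * h) = x \<and> (\<forall>i<2 * h. E (f i) (f (Suc i))) \<and>
      (w x + w y + w v - m) + m * int h \<le> (\<Sum>i<2 * h + 1. w (f i))"
    by (rule exI[of _ f], rule exI[of _ 1]) (use nbr in \<open>auto simp: f_def less_Suc_eq numeral_2_eq_2\<close>)
  then show ?case using wE[OF nbr(1)] wE[OF nbr(2)] by auto
next
  case (step z b y x)
  have zy: "w z + w y \<le> m" and yx: "w y + w x \<le> m" using wE step by blast+
  consider "b \<le> 0" | "b \<le> w z + w v - m" | f h where "f 0 = v" "f (2 * h) = z"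
    "\<forall>i<2 * h. E (f i) (f (Suc i))" "b + m * int h \<le> (\<Sum>i<2 * h + 1. w (f i))"
    using step.IH by blast
  then show ?case
  proof cases
    case 1 then show ?thesis using step.IH zy yx by linarith
  next
    case 2 then show ?thesis using step.IH zy yx by linarith
  next
    case 3
    define g where "g = f(2 * h + 1 := y, 2 * h + 2 := x)"
    have "(\<Sum>i<2 * h + 1. w (g i)) = (\<Sum>i<2 * h + 1. w (f i))"
      by (intro sum.cong) (auto simp: g_def)
    then have "(\<Sum>i<2 * Suc h + 1. w (g i)) = (\<Sum>i<2 * h + 1. w (f i)) + w y + w x"
      by (simp add: g_def)
    then have "(b + w x + w y - m) + m * int (Suc h) \<le> (\<Sum>i<2 * Suc h + 1. w (g i))"
      using 3(4) by (simp add: algebra_simps)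
    moreover have "\<forall>i<2 * Suc h. E (g i) (g (Suc i))"
      using 3 step.hyps by (auto simp: g_def less_Suc_eq)
    moreover have "g 0 = v" "g (2 * Suc h) = x" using 3(1) by (auto simp: g_def)
    ultimately show ?thesis using step.IH zy yx by (intro conjI disjI2 exI[of _ g] exI[of _ "Suc h"]) auto
  qed
qed

text \<open>The difference constraints are solved by taking the greatest forced bound on one colour
  class and the least upper constraint on the other. Feasibility comes down to \<open>p = 0\<close>
  at the neighbours of \<open>v\<close>, which \<open>walk\<close> provides.\<close>

lemma almost_bipartite_decomposable:
  fixes w :: "'v::finite \<Rightarrow> nat" and c :: "'v \<Rightarrow> bool"
  assumes G: "simple_graph E"
    and c: "\<And>x y. E x y \<Longrightarrow> x \<noteq> v \<Longrightarrow> y \<noteq> v \<Longrightarrow> c x \<noteq> c y"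
    and wm: "\<And>u. w u \<le> m" and wE: "\<And>x y. E x y \<Longrightarrow> w x + w y \<le> m"
    and walk: "\<And>F h. closed_walk E F (2 * h + 1) \<Longrightarrow> (\<Sum>i<2 * h + 1. w (F i)) \<le> m * h"
  shows "decomposable E m w"
proof -
  have sym: "E x y \<Longrightarrow> E y x" and irr: "\<not> E x x" for x y
    using G by (auto simp: simple_graph_def)
  define W where "W u = int (w u)" for u
  have W0: "0 \<le> W u" and Wm: "W u \<le> int m" for u using wm by (auto simp: W_def)
  have WE: "W x + W y \<le> int m" if "E x y" for x y
    using wE[OF that] by (simp add: W_def)
  let ?L = "forced_lower E W (int m) v"
  note bounds = forced_lower_bounds[where w = W and E = E and m = "int m" and v = v, OF W0 Wm WE,
      simplified]
  have L_nbr: "b \<le> 0" if L: "?L x b" and vx: "E v x" for x b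
  proof -
    consider "b \<le> 0" | "b \<le> W x + W v - int m" | f h where "f 0 = v" "f (2 * h) = x"
      "\<forall>i<2 * h. E (f i) (f (Suc i))" "b + int m * int h \<le> (\<Sum>i<2 * h + 1. W (f i))"
      using bounds[OF L] by auto
    then show ?thesis
    proof cases
      case 2 then show ?thesis using WE[OF vx] by simp
    next
      case 3
      \<comment> \<open>The edge from \<open>x\<close> back to \<open>v\<close> closes the recorded
        walk, so that \<open>walk\<close> applies.\<close>
      have "closed_walk E (\<lambda>i. f (i mod (2 * h + 1))) (2 * h + 1)"
        by (rule closed_walkI_cyclic) (use 3 sym[OF vx] in auto)
      from walk[OF this] have "(\<Sum>i<2 * h + 1. w (f i)) \<le> m * h" by simp
      then have "(\<Sum>i<2 * h + 1. W (f i)) \<le> int m * int h"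
        unfolding W_def by (metis of_nat_le_iff of_nat_mult of_nat_sum)
      then show ?thesis using 3(4) by simp
    qed
  qed
  \<comment> \<open>Keeping only nonnegative bounds makes the set finite, since \<open>W v\<close>
    bounds it above; for \<open>x \<noteq> v\<close> the rule \<open>zero\<close> makes it
    nonempty.\<close>
  define lo where "lo x = Max {b. ?L x b \<and> 0 \<le> b}" for x
  have fin: "finite {b. ?L x b \<and> 0 \<le> b}" for x
    by (rule finite_subset[of _ "{0..W v}"]) (use bounds in auto)
  have lo_in: "?L x (lo x) \<and> 0 \<le> lo x" if "x \<noteq> v" for x
    using Max_in[OF fin[of x]] forced_lower.zero[OF that] unfolding lo_def by blast
  have lo_ge: "b \<le> lo x" if "?L x b" "x \<noteq> v" for x b
  proof (cases "0 \<le> b")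
    case True then show ?thesis unfolding lo_def using that by (intro Max_ge[OF fin]) auto
  next
    case False then show ?thesis using lo_in[OF that(2)] by simp
  qed
  \<comment> \<open>\<open>p v = W v\<close> exhausts the edges at \<open>v\<close>, so
    \<open>p\<close> has to vanish at its neighbours. \<open>M y\<close> then collects all upper
    constraints on \<open>p y\<close>, given the values \<open>lo\<close> on the other
    class.\<close>
  define B where "B u = (if E v u then 0 else W u)" for u
  define M where "M y = insert (W v) (insert (B y) ((\<lambda>x. W v - lo x) ` {x. E y x \<and> x \<noteq> v}))" for y
  define p where "p u = (if u = v then W v else if c u then lo u else Min (M u))" for u
  have finM: "finite (M y)" "M y \<noteq> {}" for y by (auto simp: M_def)
  have lo_le: "lo x \<le> W v" "lo x \<le> B x" if "x \<noteq> v" for x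
    using lo_in[OF that] bounds L_nbr by (auto simp: B_def)
  have B: "0 \<le> B u" "B u \<le> W u" for u using W0 by (auto simp: B_def)
  have p_nonneg: "0 \<le> p u" for u
  proof (cases "u = v \<or> c u")
    case True then show ?thesis using lo_in W0 by (auto simp: p_def)
  next
    case False
    have "\<forall>z\<in>M u. 0 \<le> z" using lo_le B W0 by (auto simp: M_def)
    then show ?thesis using False finM by (simp add: p_def)
  qed
  have p_le_B: "p u \<le> B u" if "u \<noteq> v" for u
    using that lo_le Min_le[OF finM(1), of "B u" u] by (auto simp: p_def M_def)
  have p_le_v: "p u \<le> W v" for u
    using lo_le Min_le[OF finM(1), of "W v" u] by (auto simp: p_def M_def)
  have p_ge: "W u + W v - int m \<le> p u" if "u \<noteq> v" for u
  proof (cases "c u")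
    case True then show ?thesis using that lo_ge[OF forced_lower.vertex[OF that]] by (simp add: p_def)
  next
    case False
    have "W u + W v - int m \<le> z" if z: "z \<in> M u" for z
    proof -
      consider "z = W v" | "z = B u" | x where "E u x" "x \<noteq> v" "z = W v - lo x"
        using z unfolding M_def by blast
      then show ?thesis
      proof cases
        case 1 then show ?thesis using Wm[of u] by simp
      next
        case 2 then show ?thesis using WE[of v u] Wm[of v] by (auto simp: B_def)
      next
        case 3 then show ?thesis using lo_le(2)[OF 3(2)] B(2)[of x] WE[OF 3(1)] by simp
      qed
    qed
    then show ?thesis using False that finM by (simp add: p_def)
  qed
  have p_edge: "p x + p y \<le> W v \<and> W x + W y - int m + W v \<le> p x + p y"
    if xy: "E x y" "x \<noteq> v" "y \<noteq> v" "c x" for x y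
  proof -
    have "\<not> c y" using c xy by blast
    then have py: "p y = Min (M y)" and px: "p x = lo x" using xy by (auto simp: p_def)
    have "W v - lo x \<in> M y" using xy sym by (auto simp: M_def)
    then have "p y \<le> W v - lo x" using py finM by simp
    \<comment> \<open>Beyond \<open>W v\<close>, the entries of \<open>M y\<close> match the rules
      of \<open>forced_lower\<close>: \<open>B y\<close> needs \<open>nbr\<close> if
      \<open>y\<close> is a neighbour of \<open>v\<close> and \<open>vertex\<close> otherwise, and
      \<open>W v - lo x'\<close> needs \<open>step\<close>.\<close>
    moreover have "W x + W y - int m + W v - lo x \<le> z" if z: "z \<in> M y" for z
    proof -
      consider "z = W v" | "z = B y" | x' where "E y x'" "x' \<noteq> v" "z = W v - lo x'"
        using z unfolding M_def by blast
      then show ?thesis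
      proof cases
        case 1 then show ?thesis using WE[OF xy(1)] lo_in[OF xy(2)] by simp
      next
        case 2
        then show ?thesis
          using lo_ge[OF forced_lower.nbr[of E v y x W "int m"]] sym[OF xy(1)] xy(2)
            lo_ge[OF forced_lower.vertex[OF xy(2)] xy(2)] by (auto simp: B_def)
      next
        case 3
        then show ?thesis
          using lo_ge[OF forced_lower.step[of E W "int m" v x' "lo x'" y x]] lo_in[OF 3(2)]
            sym[OF 3(1)] xy(2,3) sym[OF xy(1)] by simp
      qed
    qed
    then have "W x + W y - int m + W v - lo x \<le> p y" using py finM by simp
    ultimately show ?thesis using px by linarith
  qed
  have p_edge': "p x + p y \<le> W v \<and> W x + W y - int m + W v \<le> p x + p y" if xy: "E x y" for x y
  proof -
    consider "x = v" | "y = v" | "x \<noteq> v" "y \<noteq> v" "c x" | "x \<noteq> v" "y \<noteq> v" "c y"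
      using c[OF xy] by blast
    then show ?thesis
    proof cases
      case 1
      then have "y \<noteq> v" "p y = 0" using xy irr p_le_B[of y] p_nonneg[of y] by (auto simp: B_def)
      then show ?thesis using 1 WE[OF xy] by (simp add: p_def)
    next
      case 2
      then have "x \<noteq> v" "p x = 0" using xy irr sym p_le_B[of x] p_nonneg[of x] by (auto simp: B_def)
      then show ?thesis using 2 WE[OF xy] by (simp add: p_def)
    next
      case 3 then show ?thesis using p_edge[OF xy] by simp
    next
      case 4 then show ?thesis using p_edge[OF sym[OF xy]] by (simp add: algebra_simps)
    qed
  qed
  have pv: "p v = W v" by (simp add: p_def)
  have p_le_W: "p u \<le> W u" for u using p_le_B[of u] B(2)[of u] pv by (cases "u = v") auto
  have int_p: "int (nat (p u)) = p u" for u using p_nonneg by simp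
  have "decomposable E (w v) (\<lambda>u. nat (p u))"
  proof (rule bipartite_decomposable[where c = c])
    \<comment> \<open>Edges at \<open>v\<close> drop out: \<open>p v\<close> alone reaches the edge
      bound, so the other end has weight 0. In the second part, \<open>v\<close> itself has weight
      0.\<close>
    fix x y assume xy: "E x y" "nat (p x) > 0" "nat (p y) > 0"
    then have "x \<noteq> v" "y \<noteq> v" using p_edge'[OF xy(1)] pv by auto
    then show "c x \<noteq> c y" using c xy by blast
  next
    fix u show "nat (p u) \<le> w v" using p_le_v[of u] by (simp add: W_def)
  next
    fix x y assume "E x y"
    then show "nat (p x) + nat (p y) \<le> w v"
      using p_edge'[of x y] int_p[of x] int_p[of y] unfolding W_def by linarith
  qed
  moreover have "decomposable E (m - w v) (\<lambda>u. w u - nat (p u))"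
  proof (rule bipartite_decomposable[where c = c])
    fix x y assume xy: "E x y" "w x - nat (p x) > 0" "w y - nat (p y) > 0"
    then have "x \<noteq> v" "y \<noteq> v" using pv by (auto simp: W_def)
    then show "c x \<noteq> c y" using c xy by blast
  next
    fix u show "w u - nat (p u) \<le> m - w v"
      using p_ge[of u] p_nonneg[of u] pv wm[of v] by (cases "u = v") (auto simp: W_def)
  next
    fix x y assume "E x y"
    then show "(w x - nat (p x)) + (w y - nat (p y)) \<le> m - w v"
      using p_edge'[of x y] int_p[of x] int_p[of y] p_le_W[of x] p_le_W[of y] wm[of v]
      unfolding W_def by linarith
  qed
  ultimately have "decomposable E (w v + (m - w v)) (\<lambda>u. nat (p u) + (w u - nat (p u)))"
    by (rule decomposable_add)
  moreover have "nat (p u) + (w u - nat (p u)) = w u" for u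
    using p_le_W[of u] by (simp add: W_def)
  ultimately show ?thesis using wm[of v] by simp
qed

section \<open>Induced odd cycles as closed walks\<close>

text \<open>The last clause is the absence of chords, written without reducing indices modulo the
  length.\<close>

definition cycle_walk :: "('v \<Rightarrow> 'v \<Rightarrow> bool) \<Rightarrow> 'v set \<Rightarrow> (nat \<Rightarrow> 'v) \<Rightarrow> nat \<Rightarrow> bool" where
  "cycle_walk E S F l \<longleftrightarrow> closed_walk E F (2 * l + 1) \<and> bij_betw F {..<2 * l + 1} S \<and>
    (\<forall>i j. E (F i) (F j) \<longrightarrow> F j = F (Suc i) \<or> F i = F (Suc j))"

lemma induced_odd_cycle_cycle_walk:
  assumes "induced_odd_cycle E S"
  shows "\<exists>F l. l \<ge> 1 \<and> cycle_walk E S F l"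
proof -
  obtain k f where f: "odd k" "k \<ge> 3" "bij_betw f {..<k} S"
    "\<And>i j. i < k \<Longrightarrow> j < k \<Longrightarrow> E (f i) (f j) \<longleftrightarrow> (j = Suc i mod k \<or> i = Suc j mod k)"
    using assms unfolding induced_odd_cycle_def by blast
  define F where "F i = f (i mod k)" for i
  obtain l where l: "k = 2 * l + 1" using f(1) by (elim oddE)
  have "closed_walk E F k"
    unfolding closed_walk_def F_def using f(2) by (auto simp: f(4) mod_Suc_eq)
  moreover have "bij_betw F {..<k} S"
    using f(3) by (subst bij_betw_cong[of _ F f]) (auto simp: F_def)
  moreover have "F j = F (Suc i) \<or> F i = F (Suc j)" if "E (F i) (F j)" for i j
  proof -
    have "j mod k = Suc (i mod k) mod k \<or> i mod k = Suc (j mod k) mod k"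
      using that f(2) f(4)[of "i mod k" "j mod k"] by (simp add: F_def)
    then show ?thesis unfolding F_def by (metis mod_Suc_eq)
  qed
  ultimately have "cycle_walk E S F l" unfolding cycle_walk_def l by blast
  moreover have "l \<ge> 1" using f(2) l by simp
  ultimately show ?thesis by blast
qed

lemma cycle_walk_card:
  assumes "cycle_walk E S F l"
  shows "card S = 2 * l + 1"
  using bij_betw_same_card[of F "{..<2 * l + 1}" S] assms by (simp add: cycle_walk_def)

lemma cycle_walk_range:
  assumes "cycle_walk E S F l"
  shows "range F = S"
proof -
  have cw: "closed_walk E F (2 * l + 1)" and S: "F ` {..<2 * l + 1} = S"
    using assms by (auto simp: cycle_walk_def bij_betw_def)
  have "F i \<in> S" for i
    using closed_walk_mod[OF cw, of i] S by (metis image_eqI lessThan_iff mod_less_divisor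
      zero_less_Suc Suc_eq_plus1)
  then show ?thesis using S by blast
qed

lemma cycle_walk_shift:
  assumes "cycle_walk E S F l"
  shows "cycle_walk E S (\<lambda>i. F (s + i)) l"
proof -
  let ?k = "2 * l + 1"
  have cw: "closed_walk E F ?k" and bij: "bij_betw F {..<?k} S"
    and E: "\<And>i j. E (F i) (F j) \<Longrightarrow> F j = F (Suc i) \<or> F i = F (Suc j)"
    using assms by (auto simp: cycle_walk_def)
  have img: "(\<lambda>i. F (s + i)) ` {..<?k} = S"
  proof
    show "(\<lambda>i. F (s + i)) ` {..<?k} \<subseteq> S" using cycle_walk_range[OF assms] by blast
    show "S \<subseteq> (\<lambda>i. F (s + i)) ` {..<?k}"
    proof
      fix x assume "x \<in> S"
      then obtain j where j: "x = F j" using cycle_walk_range[OF assms] by blast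
      \<comment> \<open>As \<open>s + ?n = j + s * (2 * l + 1)\<close>, this index stands for
        \<open>j - s\<close> modulo the period, without truncated subtraction.\<close>
      let ?n = "j + s * (2 * l)"
      have "F (s + ?n mod ?k) = F ((s + ?n mod ?k) mod ?k)" using closed_walk_mod[OF cw] by metis
      also have "\<dots> = F ((s + ?n) mod ?k)" by (simp only: mod_add_right_eq)
      also have "s + ?n = j + s * ?k" by simp
      also have "F ((j + s * ?k) mod ?k) = F (j mod ?k)" by (simp only: mod_mult_self1)
      also have "\<dots> = x" using closed_walk_mod[OF cw] j by metis
      finally show "x \<in> (\<lambda>i. F (s + i)) ` {..<?k}"
        by (metis (no_types, lifting) image_eqI lessThan_iff mod_less_divisor zero_less_Suc Suc_eq_plus1)
    qed
  qed
  then have "inj_on (\<lambda>i. F (s + i)) {..<?k}"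
    using cycle_walk_card[OF assms] by (intro eq_card_imp_inj_on) auto
  with img have "bij_betw (\<lambda>i. F (s + i)) {..<?k} S" by (simp add: bij_betw_def)
  moreover have "closed_walk E (\<lambda>i. F (s + i)) ?k"
    using cw by (auto simp: closed_walk_def add.assoc[symmetric])
  moreover have "F (s + j) = F (s + Suc i) \<or> F (s + i) = F (s + Suc j)" if "E (F (s + i)) (F (s + j))" for i j
    using E[OF that] by simp
  ultimately show ?thesis unfolding cycle_walk_def by blast
qed

lemma cycle_walk_from:
  assumes "cycle_walk E S F l" "v \<in> S"
  shows "\<exists>F. cycle_walk E S F l \<and> F 0 = v"
proof -
  obtain s where "v = F s" using cycle_walk_range[OF assms(1)] assms(2) by blast
  then show ?thesis using cycle_walk_shift[OF assms(1), of s] by (intro exI[of _ "\<lambda>i. F (s + i)"]) simp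
qed

text \<open>Edges join consecutive positions, and the positions up to \<open>2 * l\<close> stay
  below the period, so no wrap-around spoils the parity.\<close>

lemma cycle_walk_odd_independent:
  assumes "cycle_walk E S F l"
  shows "independent E ((\<lambda>j. F (2 * j + 1)) ` {..<l})"
  unfolding independent_def
proof (intro ballI notI)
  fix u v assume "u \<in> (\<lambda>j. F (2 * j + 1)) ` {..<l}" "v \<in> (\<lambda>j. F (2 * j + 1)) ` {..<l}" "E u v"
  then obtain i j where ij: "i < l" "j < l" "E (F (2 * i + 1)) (F (2 * j + 1))" by auto
  have inj: "inj_on F {..<2 * l + 1}"
    and "F (2 * j + 1) = F (2 * i + 2) \<or> F (2 * i + 1) = F (2 * j + 2)"
    using assms ij(3) by (force simp: cycle_walk_def bij_betw_def)+
  then have "2 * j + 1 = 2 * i + 2 \<or> 2 * i + 1 = 2 * j + 2"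
    using inj_onD[OF inj] ij by force
  then show False by presburger
qed

lemma sum_cycle_walk:
  fixes w :: "'v \<Rightarrow> nat"
  assumes "cycle_walk E S F l"
  shows "sum w S = (\<Sum>i<2 * l + 1. w (F i))"
  using assms unfolding cycle_walk_def by (metis sum.reindex_bij_betw)

section \<open>Powers of the cover ideal\<close>

text \<open>These are the exponents whose support is a vertex cover.\<close>

definition covers :: "('v \<Rightarrow> 'v \<Rightarrow> bool) \<Rightarrow> ('v \<Rightarrow>\<^sub>0 nat) set" where
  "covers E = {a. \<forall>u v. E u v \<longrightarrow> 1 \<le> weight_on {u, v} a}"

lemma weight_on_pair: "u \<noteq> v \<Longrightarrow> weight_on {u, v} a = lookup a u + lookup a v"
  by (simp add: weight_on_def)

lemma weight_on_edge: "simple_graph E \<Longrightarrow> E u v \<Longrightarrow> weight_on {u, v} a = lookup a u + lookup a v"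
  by (rule weight_on_pair) (auto simp: simple_graph_def)

lemma cover_ideal_eq_mon_ideal:
  "cover_ideal E = (mon_ideal (covers E) :: ('v::finite, 'k::field) mpoly set)"
proof -
  have "ideal_gen {var u, var v} = (mon_ideal {a. 1 \<le> weight_on {u, v} a} :: ('v, 'k) mpoly set)" for u v
    using ideal_gen_var[of "{u, v}"] by simp
  then have "f \<in> cover_ideal E \<longleftrightarrow> (\<forall>u v. E u v \<longrightarrow> f \<in> mon_ideal {a. 1 \<le> weight_on {u, v} a})"
    for f :: "('v, 'k) mpoly"
    unfolding cover_ideal_def by blast
  then show ?thesis unfolding covers_def mon_ideal_def by blast
qed

lemma weight_on_exponent_pow_ge:
  assumes "\<And>b. b \<in> U \<Longrightarrow> t \<le> weight_on A b" "a \<in> exponent_pow U m"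
  shows "m * t \<le> weight_on A a"
  using assms(2)
proof (induction m arbitrary: a)
  case (Suc m)
  then obtain a' b where a: "a = a' + b" "a' \<in> exponent_pow U m" "b \<in> U" by auto
  show ?case using Suc.IH[OF a(2)] assms(1)[OF a(3)] by (simp add: a(1) weight_on_add)
qed simp

text \<open>The complement of each \<open>T i\<close> is a vertex cover, and the indicators of these
  complements add up to the given count. The surplus of \<open>a\<close> goes into the factor
  \<open>UNIV\<close>.\<close>

lemma exponent_pow_coversI:
  fixes a :: "'v::finite \<Rightarrow>\<^sub>0 nat"
  assumes G: "simple_graph E" and T: "\<And>i. i < m \<Longrightarrow> independent E (T i)"
    and a: "\<And>u. card {i. i < m \<and> u \<notin> T i} \<le> lookup a u"
  shows "a \<in> exponent_pow (covers E) m"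
  using T a
proof (induction m arbitrary: a)
  case (Suc m)
  define b where "b = Abs_poly_mapping (\<lambda>u. of_bool (u \<notin> T m) :: nat)"
  have b: "lookup b u = of_bool (u \<notin> T m)" for u by (simp add: b_def)
  have cnt: "card {i. i < Suc m \<and> u \<notin> T i} = card {i. i < m \<and> u \<notin> T i} + of_bool (u \<notin> T m)" for u
  proof (cases "u \<in> T m")
    case True
    then have "{i. i < Suc m \<and> u \<notin> T i} = {i. i < m \<and> u \<notin> T i}" by (auto simp: less_Suc_eq)
    then show ?thesis using True by simp
  next
    case False
    then have "{i. i < Suc m \<and> u \<notin> T i} = insert m {i. i < m \<and> u \<notin> T i}" by (auto simp: less_Suc_eq)
    then show ?thesis using False by simp
  qed
  have le: "card {i. i < m \<and> u \<notin> T i} + lookup b u \<le> lookup a u" for u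
    using Suc.prems(2)[of u] by (simp add: cnt b)
  have "a = (a - b) + b"
  proof (rule poly_mapping_eqI)
    fix u show "lookup a u = lookup (a - b + b) u" using le[of u] by (simp add: lookup_add lookup_minus)
  qed
  moreover have "a - b \<in> exponent_pow (covers E) m"
  proof (rule Suc.IH)
    fix u show "card {i. i < m \<and> u \<notin> T i} \<le> lookup (a - b) u" using le[of u] by (simp add: lookup_minus)
  qed (use Suc.prems in auto)
  moreover have "b \<in> covers E"
    using Suc.prems(1)[of m] G by (auto simp: covers_def weight_on_edge b independent_def)
  ultimately show ?case by auto
qed simp

text \<open>The weight is truncated: a vertex with exponent at least \<open>m\<close> lies in none
  of the sets, and its exponent suffices for all \<open>m\<close> complements.\<close>

lemma decomposable_exponent_pow_covers:
  fixes a :: "'v::finite \<Rightarrow>\<^sub>0 nat"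
  assumes G: "simple_graph E" and d: "decomposable E m (\<lambda>u. m - lookup a u)"
  shows "a \<in> exponent_pow (covers E) m"
proof -
  obtain T where T: "\<forall>i<m. independent E (T i)" "\<forall>u. m - lookup a u = card {i. i < m \<and> u \<in> T i}"
    using d unfolding decomposable_def by blast
  have "card {i. i < m \<and> u \<notin> T i} \<le> lookup a u" for u
  proof -
    have "{..<m} = {i. i < m \<and> u \<in> T i} \<union> {i. i < m \<and> u \<notin> T i}" by auto
    then have "m = card ({i. i < m \<and> u \<in> T i} \<union> {i. i < m \<and> u \<notin> T i})" by (metis card_lessThan)
    also have "\<dots> = card {i. i < m \<and> u \<in> T i} + card {i. i < m \<and> u \<notin> T i}"
      by (rule card_Un_disjoint) auto
    finally show ?thesis using spec[OF T(2), of u] by linarith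
  qed
  then show ?thesis using exponent_pow_coversI[OF G] T(1) by blast
qed

lemma edge_weight_exponent_pow_ge:
  "E u v \<Longrightarrow> a \<in> exponent_pow (covers E) m \<Longrightarrow> m \<le> weight_on {u, v} a"
  using weight_on_exponent_pow_ge[of "covers E" 1 "{u, v}" a m] by (auto simp: covers_def)

lemma cycle_weight_cover_ge:
  assumes G: "simple_graph E" and S: "cycle_walk E S F l" and b: "b \<in> covers E"
  shows "l + 1 \<le> weight_on S b"
proof -
  have cw: "closed_walk E F (2 * l + 1)" using S by (simp add: cycle_walk_def)
  \<comment> \<open>Counts over the edges of the cycle: every vertex lies on two of them, each has
    degree at least 1, and half of \<open>2 * l + 1\<close> rounds up to
    \<open>l + 1\<close>.\<close>
  have "2 * weight_on S b = (\<Sum>i<2 * l + 1. lookup b (F i)) + (\<Sum>i<2 * l + 1. lookup b (F (1 + i)))"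
    using sum_cycle_walk[OF S, of "lookup b"] sum_closed_walk_shift[OF cw, of "lookup b" 1]
    by (simp add: weight_on_def)
  also have "\<dots> = (\<Sum>i<2 * l + 1. lookup b (F i) + lookup b (F (Suc i)))"
    by (simp add: sum.distrib)
  also have "\<dots> \<ge> (\<Sum>i<2 * l + 1. 1)"
  proof (rule sum_mono)
    fix i
    have "E (F i) (F (Suc i))" using cw by (simp add: closed_walk_def)
    then show "1 \<le> lookup b (F i) + lookup b (F (Suc i))"
      using b weight_on_edge[OF G] unfolding covers_def by fastforce
  qed
  finally show ?thesis by simp
qed

lemma cycle_weight_exponent_pow_ge:
  assumes "simple_graph E" "cycle_walk E S F l" "a \<in> exponent_pow (covers E) m"
  shows "m * (l + 1) \<le> weight_on S a"
  by (rule weight_on_exponent_pow_ge[OF cycle_weight_cover_ge[OF assms(1,2)] assms(3)])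

lemma bipartite_exponent_pow:
  fixes E :: "'v::finite \<Rightarrow> 'v \<Rightarrow> bool"
  assumes G: "simple_graph E" and "bipartite E"
  shows "exponent_pow (covers E) m = {a. \<forall>A\<in>{{u, v} |u v. E u v}. m \<le> weight_on A a}"
proof
  show "exponent_pow (covers E) m \<subseteq> {a. \<forall>A\<in>{{u, v} |u v. E u v}. m \<le> weight_on A a}"
    by (auto intro: edge_weight_exponent_pow_ge)
  show "{a. \<forall>A\<in>{{u, v} |u v. E u v}. m \<le> weight_on A a} \<subseteq> exponent_pow (covers E) m"
  proof
    fix a assume "a \<in> {a. \<forall>A\<in>{{u, v} |u v. E u v}. m \<le> weight_on A a}"
    then have "\<forall>u v. E u v \<longrightarrow> m \<le> weight_on {u, v} a" by auto
    then have a: "m \<le> lookup a u + lookup a v" if "E u v" for u v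
      using that by (simp flip: weight_on_edge[OF G that])
    obtain c :: "'v \<Rightarrow> bool" where c: "\<And>u v. E u v \<Longrightarrow> c u \<noteq> c v"
      using assms(2) by (auto simp: bipartite_def)
    have "decomposable E m (\<lambda>u. m - lookup a u)"
      by (rule bipartite_decomposable[where c = c]) (use c a in \<open>force+\<close>)
    then show "a \<in> exponent_pow (covers E) m" by (rule decomposable_exponent_pow_covers[OF G])
  qed
qed

lemma almost_bipartite_exponent_pow:
  fixes E :: "'v::finite \<Rightarrow> 'v \<Rightarrow> bool"
  assumes G: "simple_graph E" and S: "cycle_walk E S F l"
    and uniq: "\<And>S'. induced_odd_cycle E S' \<Longrightarrow> S' = S"
  shows "exponent_pow (covers E) m =
    {a. (\<forall>u v. E u v \<longrightarrow> m \<le> weight_on {u, v} a) \<and> m * (l + 1) \<le> weight_on S a}" (is "_ = ?R")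
proof
  show "exponent_pow (covers E) m \<subseteq> ?R"
    using cycle_weight_exponent_pow_ge[OF G S] by (auto intro: edge_weight_exponent_pow_ge)
  show "?R \<subseteq> exponent_pow (covers E) m"
  proof
    fix a assume a: "a \<in> ?R"
    define w where "w u = m - lookup a u" for u
    have wE: "w u + w v \<le> m" if "E u v" for u v
    proof -
      have "m \<le> lookup a u + lookup a v" using a that by (simp add: weight_on_edge[OF G that, symmetric])
      then show ?thesis by (simp add: w_def)
    qed
    \<comment> \<open>If \<open>w s = 0\<close> for some \<open>s\<close>, the rest of the cycle is
      a path covered by \<open>l\<close> disjoint edges. Otherwise nothing was truncated, and the
      bound on \<open>weight_on S a\<close> passes exactly to the complement.\<close>
    have wS: "sum w S \<le> m * l"
    proof (cases "\<exists>s\<in>S. w s = 0")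
      case True
      then obtain s where s: "s \<in> S" "w s = 0" by blast
      then obtain F' where F': "cycle_walk E S F' l" "F' 0 = s" using cycle_walk_from[OF S] by blast
      have "sum w S = w (F' 0) + (\<Sum>i<2 * l. w (F' (1 + i)))"
        unfolding sum_cycle_walk[OF F'(1)] Suc_eq_plus1[symmetric] by (subst sum.lessThan_Suc_shift) simp
      also have "\<dots> \<le> 0 + m * l"
        by (intro add_mono sum_walk_pairs_le[of E])
           (use s F' wE in \<open>auto simp: cycle_walk_def closed_walk_def\<close>)
      finally show ?thesis by simp
    next
      case False
      have "w s + lookup a s = m" if "s \<in> S" for s using False that by (force simp: w_def)
      then have "sum w S + weight_on S a = (\<Sum>s\<in>S. m)"
        unfolding weight_on_def sum.distrib[symmetric] by (intro sum.cong) auto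
      also have "\<dots> = m * (2 * l + 1)" using cycle_walk_card[OF S] by simp
      finally show ?thesis using a by (simp add: algebra_simps)
    qed
    have walk: "(\<Sum>i<2 * h + 1. w (f i)) \<le> m * h" if f: "closed_walk E f (2 * h + 1)" for f h
    proof -
      obtain S' where "induced_odd_cycle E S'" "card S' \<le> 2 * h + 1"
        "(\<Sum>i<2 * h + 1. w (f i)) \<le> sum w S' + m * ((2 * h + 1 - card S') div 2)"
        using odd_closed_walk_contains_induced_odd_cycle[OF G f] wE by auto
      then have h: "2 * l + 1 \<le> 2 * h + 1"
        and le: "(\<Sum>i<2 * h + 1. w (f i)) \<le> sum w S + m * ((2 * h + 1 - (2 * l + 1)) div 2)"
        using uniq cycle_walk_card[OF S] by metis+
      have "(2 * h + 1 - (2 * l + 1)) div 2 = h - l" by simp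
      then have "(\<Sum>i<2 * h + 1. w (f i)) \<le> m * l + m * (h - l)" using le wS by simp
      also have "\<dots> = m * h" using h by (simp add: distrib_left[symmetric])
      finally show ?thesis .
    qed
    have "F 0 \<in> S" using cycle_walk_range[OF S] by blast
    then have "bipartite (\<lambda>x y. E x y \<and> x \<noteq> F 0 \<and> y \<noteq> F 0)"
      using bipartite_delete_vertex[of E S, OF G] uniq by simp
    then obtain c :: "'v \<Rightarrow> bool" where c: "\<And>x y. E x y \<Longrightarrow> x \<noteq> F 0 \<Longrightarrow> y \<noteq> F 0 \<Longrightarrow> c x \<noteq> c y"
      by (auto simp: bipartite_def)
    have "decomposable E m w"
      by (rule almost_bipartite_decomposable[OF G, where v = "F 0" and c = c])
         (use c wE walk in \<open>simp_all add: w_def\<close>)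
    then show "a \<in> exponent_pow (covers E) m"
      unfolding w_def by (rule decomposable_exponent_pow_covers[OF G])
  qed
qed

section \<open>Associated primes\<close>

lemma edge_prime_in_Ass:
  fixes E :: "'v::finite \<Rightarrow> 'v \<Rightarrow> bool"
  assumes G: "simple_graph E" and uv: "E u v" and m: "m \<ge> 1"
  shows "ideal_gen (var ` {u, v}) \<in> Ass (ideal_pow (cover_ideal E :: ('v, 'k::field) mpoly set) m)"
proof -
  have ne: "u \<noteq> v" using G uv by (auto simp: simple_graph_def)
  \<comment> \<open>The degree on the edge is \<open>m - 1\<close>, one too small. If
    \<open>b\<close> raises \<open>u\<close>, then \<open>m\<close> covers omitting only
    \<open>v\<close> suffice; if it raises \<open>v\<close>, one of them is replaced by the cover
    omitting only \<open>u\<close>.\<close>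
  define a where "a = Abs_poly_mapping (\<lambda>x. if x = v then 0 else if x = u then m - 1 else m)"
  have a: "lookup a x = (if x = v then 0 else if x = u then m - 1 else m)" for x
    by (simp add: a_def)
  have ind: "independent E {x}" for x using G by (auto simp: independent_def simple_graph_def)
  have "b + a \<in> exponent_pow (covers E) m \<longleftrightarrow> 1 \<le> weight_on {u, v} b" for b
  proof
    assume "b + a \<in> exponent_pow (covers E) m"
    then have "m \<le> weight_on {u, v} (b + a)" using edge_weight_exponent_pow_ge[of E, OF uv] by blast
    then show "1 \<le> weight_on {u, v} b" using m ne by (auto simp: weight_on_pair lookup_add a)
  next
    assume "1 \<le> weight_on {u, v} b"
    then consider "1 \<le> lookup b u" | "1 \<le> lookup b v" using ne by (auto simp: weight_on_pair) linarith
    then show "b + a \<in> exponent_pow (covers E) m"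
    proof cases
      case 1
      have "card {i. i < m \<and> x \<notin> {v}} \<le> lookup (b + a) x" for x
        using 1 by (cases "x = v") (auto simp: lookup_add a)
      then show ?thesis using exponent_pow_coversI[OF G, of m "\<lambda>_. {v}"] ind by blast
    next
      case 2
      define T where "T i = (if i = 0 then {u} else {v})" for i :: nat
      have "{i. i < m \<and> v \<notin> T i} \<subseteq> {0}" "{i. i < m \<and> u \<notin> T i} \<subseteq> {1..<m}"
        "{i. i < m \<and> x \<notin> T i} \<subseteq> {..<m}" for x
        by (auto simp: T_def)
      then have "card {i. i < m \<and> v \<notin> T i} \<le> 1" "card {i. i < m \<and> u \<notin> T i} \<le> m - 1"
        "card {i. i < m \<and> x \<notin> T i} \<le> m" for x
        by (metis card_mono card.empty card_insert_disjoint finite.emptyI finite_insert empty_iff One_nat_def,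
            metis card_mono card_atLeastLessThan finite_atLeastLessThan,
            metis card_mono card_lessThan finite_lessThan)
      then have "card {i. i < m \<and> x \<notin> T i} \<le> lookup (b + a) x" for x
        using 2 le_trans by (auto simp: lookup_add a trans_le_add2)
      then show ?thesis using exponent_pow_coversI[OF G, of m T] ind by (auto simp: T_def)
    qed
  qed
  then show ?thesis
    unfolding cover_ideal_eq_mon_ideal ideal_pow_mon_ideal by (rule ideal_gen_var_in_Ass)
qed

text \<open>The witness has \<open>S\<close>-degree one less than the minimum \<open>m * (l + 1)\<close> on the \<open>m\<close>-th power.\<close>
lemma odd_cycle_prime_in_Ass:
  fixes E :: "'v::finite \<Rightarrow> 'v \<Rightarrow> bool"
  assumes G: "simple_graph E" and S: "induced_odd_cycle E S" and m: "m \<ge> 2"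
  shows "ideal_gen (var ` S) \<in> Ass (ideal_pow (cover_ideal E :: ('v, 'k::field) mpoly set) m)"
proof -
  obtain F l where F: "cycle_walk E S F l" using induced_odd_cycle_cycle_walk[OF S] by blast
  define T where "T = (\<lambda>j. F (2 * j + 1)) ` {..<l}"
  have TS: "T \<subseteq> S" using cycle_walk_range[OF F] by (auto simp: T_def)
  have "inj_on F {..<2 * l + 1}" using F by (simp add: cycle_walk_def bij_betw_def)
  then have "inj_on (\<lambda>j. F (2 * j + 1)) {..<l}" by (force intro!: inj_onI dest: inj_onD)
  then have cT: "card T = l" by (simp add: T_def card_image)
  obtain n where n: "m = n + 2" using m by (metis le_add_diff_inverse2)
  \<comment> \<open>On \<open>S\<close> this is \<open>n = m - 2\<close> copies of the cover
    \<open>S - T\<close> plus 1 at each vertex: two more covers need degree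
    \<open>2 * l + 2\<close>, and the ones give \<open>2 * l + 1\<close>. Off \<open>S\<close> the
    value \<open>m\<close> always suffices.\<close>
  define a where "a = Abs_poly_mapping (\<lambda>x. if x \<in> S then 1 + n * of_bool (x \<notin> T) else m)"
  have a: "lookup a x = (if x \<in> S then 1 + n * of_bool (x \<notin> T) else m)" for x
    by (simp add: a_def)
  have "weight_on S a = (\<Sum>x\<in>S. 1 + n * of_bool (x \<notin> T))"
    unfolding weight_on_def by (intro sum.cong) (auto simp: a)
  also have "\<dots> = card S + n * card (S - T)"
  proof -
    have "(\<Sum>x\<in>S. of_bool (x \<notin> T)) = card (S - T)"
      by (simp add: set_diff_eq sum_of_bool_eq Int_def)
    then show ?thesis by (simp only: sum.distrib sum_distrib_left[symmetric]) simp
  qed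
  also have "card (S - T) = l + 1" using TS cT cycle_walk_card[OF F] by (simp add: card_Diff_subset)
  finally have wa: "Suc (weight_on S a) = m * (l + 1)"
    using cycle_walk_card[OF F] by (simp add: n algebra_simps)
  have "b + a \<in> exponent_pow (covers E) m \<longleftrightarrow> 1 \<le> weight_on S b" for b
  proof
    assume "b + a \<in> exponent_pow (covers E) m"
    then show "1 \<le> weight_on S b"
      using cycle_weight_exponent_pow_ge[OF G F, of "b + a" m] wa by (simp add: weight_on_add)
  next
    assume "1 \<le> weight_on S b"
    then obtain v where v: "v \<in> S" "1 \<le> lookup b v"
      unfolding weight_on_def by (metis less_one not_le sum.neutral)
    obtain F' where F': "cycle_walk E S F' l" "F' 0 = v" using cycle_walk_from[OF F v(1)] by blast
    have F'': "cycle_walk E S (\<lambda>i. F' (1 + i)) l" by (rule cycle_walk_shift[OF F'(1)])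
    \<comment> \<open>Counted from \<open>v\<close>, the odd and the positive even positions exhaust
      \<open>S\<close> apart from \<open>v\<close>. So within \<open>S\<close> the two complements
      overlap only at \<open>v\<close>, where \<open>b\<close> supplies the missing unit.\<close>
    define T0 where "T0 = (\<lambda>j. F' (2 * j + 1)) ` {..<l}"
    define T1 where "T1 = (\<lambda>j. F' (1 + (2 * j + 1))) ` {..<l}"
    define R where "R i = (if i = 0 then T0 else if i = 1 then T1 else T)" for i :: nat
    have ind: "independent E (R i)" for i
      using cycle_walk_odd_independent[OF F'(1)] cycle_walk_odd_independent[OF F'']
        cycle_walk_odd_independent[OF F] by (auto simp: R_def T0_def T1_def T_def)
    have cover: "x \<in> T0 \<union> T1" if x: "x \<in> S" "x \<noteq> v" for x
    proof -
      obtain i where i: "i < 2 * l + 1" "x = F' i"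
        using F'(1) x(1) by (auto simp: cycle_walk_def bij_betw_def)
      have "i \<noteq> 0" using i x(2) F'(2) by metis
      show ?thesis
      proof (cases "even i")
        case True
        then obtain j where "i = 2 * j" by blast
        then have "1 + (2 * (j - 1) + 1) = i" "j - 1 < l" using i \<open>i \<noteq> 0\<close> by auto
        then have "x = F' (1 + (2 * (j - 1) + 1))" "j - 1 < l" using i by auto
        then show ?thesis unfolding T1_def by blast
      next
        case False
        then obtain j where "i = 2 * j + 1" by (elim oddE)
        then show ?thesis using i unfolding T0_def by auto
      qed
    qed
    have "card {i. i < m \<and> x \<notin> R i} \<le> lookup (b + a) x" for x
    proof (cases "x \<in> S")
      case False
      have "card {i. i < m \<and> x \<notin> R i} \<le> card {..<m}" by (intro card_mono) auto
      then show ?thesis using False by (simp add: lookup_add a)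
    next
      case True
      let ?N = "if x \<in> T then {} else {2..<m}"
      have cN: "card ?N = n * of_bool (x \<notin> T)" by (simp add: n)
      have "card {i. i < m \<and> x \<notin> R i} \<le> card ({i. i < 2 \<and> x \<notin> R i} \<union> ?N)"
        by (intro card_mono) (auto simp: R_def)
      also have "\<dots> \<le> card {i. i < 2 \<and> x \<notin> R i} + card ?N" by (rule card_Un_le)
      also have "card {i. i < 2 \<and> x \<notin> R i} \<le> 1 + lookup b x"
      proof (cases "x = v")
        case True
        have "card {i. i < 2 \<and> x \<notin> R i} \<le> card {..<2::nat}" by (intro card_mono) auto
        then show ?thesis using True v(2) by simp
      next
        case False
        then consider "x \<in> R 0" | "x \<in> R 1" using cover \<open>x \<in> S\<close> by (auto simp: R_def)
        then show ?thesis
        proof cases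
          case 1
          have "{i. i < 2 \<and> x \<notin> R i} \<subseteq> {1}" using 1 by (auto simp: less_2_cases_iff)
          then have "card {i. i < 2 \<and> x \<notin> R i} \<le> card {1::nat}" by (intro card_mono) auto
          then show ?thesis by simp
        next
          case 2
          have "{i. i < 2 \<and> x \<notin> R i} \<subseteq> {0}" using 2 by (auto simp: less_2_cases_iff)
          then have "card {i. i < 2 \<and> x \<notin> R i} \<le> card {0::nat}" by (intro card_mono) auto
          then show ?thesis by simp
        qed
      qed
      finally show ?thesis using True cN by (simp add: lookup_add a)
    qed
    then show "b + a \<in> exponent_pow (covers E) m" using exponent_pow_coversI[OF G, of m R] ind by blast
  qed
  then show ?thesis
    unfolding cover_ideal_eq_mon_ideal ideal_pow_mon_ideal by (rule ideal_gen_var_in_Ass)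
qed

section \<open>Upper bounds for the associated primes, and the equivalence\<close>

lemma Ass_cover_ideal_subset:
  fixes E :: "'v::finite \<Rightarrow> 'v \<Rightarrow> bool"
  shows "Ass (cover_ideal E :: ('v, 'k::field) mpoly set) \<subseteq> {ideal_gen (var ` {u, v}) |u v. E u v}"
proof -
  have "covers E = {a. \<forall>A\<in>{{u, v} |u v. E u v}. 1 \<le> weight_on A a}" by (auto simp: covers_def)
  then show ?thesis
    using Ass_weight_ideal_subset[where 'k = 'k, of "{{u, v} |u v. E u v}" "\<lambda>_. 1"]
    unfolding cover_ideal_eq_mon_ideal by force
qed

lemma Ass_pow_cover_ideal_bipartite:
  fixes E :: "'v::finite \<Rightarrow> 'v \<Rightarrow> bool"
  assumes "simple_graph E" "bipartite E"
  shows "Ass (ideal_pow (cover_ideal E :: ('v, 'k::field) mpoly set) m)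
    \<subseteq> {ideal_gen (var ` {u, v}) |u v. E u v}"
  using Ass_weight_ideal_subset[where 'k = 'k, of "{{u, v} |u v. E u v}" "\<lambda>_. m"]
  unfolding cover_ideal_eq_mon_ideal ideal_pow_mon_ideal bipartite_exponent_pow[OF assms] by force

lemma induced_odd_cycle_card_ge_3:
  assumes "induced_odd_cycle E S"
  shows "card S \<ge> 3"
proof -
  obtain F l where "l \<ge> 1" "cycle_walk E S F l" using induced_odd_cycle_cycle_walk[OF assms] by blast
  then show ?thesis using cycle_walk_card[of E S F l] by simp
qed

lemma induced_odd_cycle_not_edge:
  assumes "induced_odd_cycle E S"
  shows "S \<noteq> {u, v}"
proof
  assume "S = {u, v}"
  then have "card S \<le> 2" by (simp add: card_insert_if)
  then show False using induced_odd_cycle_card_ge_3[OF assms] by simp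
qed

lemma Ass_pow_cover_ideal_almost_bipartite:
  fixes E :: "'v::finite \<Rightarrow> 'v \<Rightarrow> bool"
  assumes G: "simple_graph E" and S: "induced_odd_cycle E S"
    and uniq: "\<And>S'. induced_odd_cycle E S' \<Longrightarrow> S' = S"
  shows "Ass (ideal_pow (cover_ideal E :: ('v, 'k::field) mpoly set) m)
    \<subseteq> insert (ideal_gen (var ` S)) {ideal_gen (var ` {u, v}) |u v. E u v}"
proof -
  obtain F l where F: "cycle_walk E S F l" using induced_odd_cycle_cycle_walk[OF S] by blast
  \<comment> \<open>One threshold function serves both kinds of conditions, as the cycle
    \<open>S\<close> is never an edge.\<close>
  define t where "t A = (if A = S then m * (l + 1) else m)" for A
  have "exponent_pow (covers E) m = {a. \<forall>A\<in>insert S {{u, v} |u v. E u v}. t A \<le> weight_on A a}"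
  proof -
    have "t {u, v} = m" "t S = m * (l + 1)" for u v
      using induced_odd_cycle_not_edge[OF S] by (auto simp: t_def)
    then have "(\<forall>A\<in>insert S {{u, v} |u v. E u v}. t A \<le> weight_on A a) \<longleftrightarrow>
        (\<forall>u v. E u v \<longrightarrow> m \<le> weight_on {u, v} a) \<and> m * (l + 1) \<le> weight_on S a" for a
      by (simp del: mult_Suc_right) metis
    then show ?thesis using almost_bipartite_exponent_pow[OF G F, of m] uniq by simp
  qed
  then show ?thesis
    using Ass_weight_ideal_subset[where 'k = 'k, of "insert S {{u, v} |u v. E u v}" t]
    unfolding cover_ideal_eq_mon_ideal ideal_pow_mon_ideal by force
qed

text \<open>The first power is \<open>UNIV\<close> times the ideal; this changes nothing because
  \<open>covers E\<close> is up-closed.\<close>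

lemma ideal_pow_cover_ideal_1:
  "ideal_pow (cover_ideal E :: ('v::finite, 'k::field) mpoly set) 1 = cover_ideal E"
proof -
  have "upclosed (covers E)"
    unfolding upclosed_def covers_def by (auto simp: weight_on_add trans_le_add2)
  then have "exponent_pow (covers E) 1 = covers E"
    unfolding One_nat_def exponent_pow.simps upclosed_def by (auto intro: exI[of _ 0])
  then show ?thesis unfolding cover_ideal_eq_mon_ideal ideal_pow_mon_ideal by simp
qed

theorem theorem4p1:
  fixes E :: "'v::finite \<Rightarrow> 'v \<Rightarrow> bool"
  assumes "simple_graph E" and "connected_graph E"
  shows "nearly_copersistent (cover_ideal E :: ('v, 'k::field) mpoly set)
         \<longleftrightarrow> bipartite E \<or> almost_bipartite E"
proof
  let ?J = "cover_ideal E :: ('v, 'k) mpoly set"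
  let ?p = "\<lambda>A. ideal_gen (var ` A) :: ('v, 'k) mpoly set"
  assume "nearly_copersistent ?J"
  then obtain s p where "s \<ge> 1"
    "\<forall>m. 1 \<le> m \<and> m \<le> s \<longrightarrow> Ass (ideal_pow ?J (m + 1)) \<subseteq> Ass (ideal_pow ?J m) \<union> {p}"
    unfolding nearly_copersistent_def by (elim exE conjE)
  \<comment> \<open>The second power may add only the prime \<open>p\<close>, whereas every induced
    odd cycle adds its own prime.\<close>
  then have p: "Ass (ideal_pow ?J (1 + 1)) \<subseteq> Ass (ideal_pow ?J 1) \<union> {p}"
    by (metis order_refl)
  have eq_p: "?p S = p" if S: "induced_odd_cycle E S" for S
  proof -
    have "?p S \<in> Ass (ideal_pow ?J (1 + 1))" by (rule odd_cycle_prime_in_Ass[OF assms(1) S]) simp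
    moreover have "?p S \<notin> Ass (ideal_pow ?J 1)"
      unfolding ideal_pow_cover_ideal_1
    proof
      assume "?p S \<in> Ass ?J"
      then obtain u v where "?p S = ?p {u, v}" using Ass_cover_ideal_subset by blast
      then show False using ideal_gen_var_inj induced_odd_cycle_not_edge[OF S] by blast
    qed
    ultimately show ?thesis using p by blast
  qed
  show "bipartite E \<or> almost_bipartite E"
  proof (cases "bipartite E")
    case False
    then obtain S where S: "induced_odd_cycle E S"
      using not_bipartite_induced_odd_cycle[OF assms(1)] by blast
    have "S' = S" if "induced_odd_cycle E S'" for S'
      using eq_p[OF that] eq_p[OF S] by (intro ideal_gen_var_inj[where 'k = 'k]) simp
    then show ?thesis unfolding almost_bipartite_def using S by blast
  qed simp
next
  let ?J = "cover_ideal E :: ('v, 'k) mpoly set"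
  let ?p = "\<lambda>A. ideal_gen (var ` A) :: ('v, 'k) mpoly set"
  have edges: "{?p {u, v} |u v. E u v} \<subseteq> Ass (ideal_pow ?J m)" if "m \<ge> 1" for m
    using edge_prime_in_Ass[where 'k = 'k, OF assms(1) _ that] by blast
  assume "bipartite E \<or> almost_bipartite E"
  \<comment> \<open>Prepares \<open>s = 1\<close>: edge primes occur from the first power on, the
    cycle prime from the second.\<close>
  then obtain S where bound: "\<And>m. Ass (ideal_pow ?J m) \<subseteq> insert (?p S) {?p {u, v} |u v. E u v}"
    and pers: "\<And>m. m \<ge> 2 \<Longrightarrow> Ass (ideal_pow ?J (m + 1)) \<subseteq> Ass (ideal_pow ?J m)"
  proof
    assume b: "bipartite E"
    show thesis
    proof
      \<comment> \<open>A bipartite graph has no exceptional prime; the zero ideal, generated by no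
        variables, fills its place.\<close>
      show "Ass (ideal_pow ?J m) \<subseteq> insert (?p {}) {?p {u, v} |u v. E u v}" for m
        using Ass_pow_cover_ideal_bipartite[OF assms(1) b] by blast
      show "Ass (ideal_pow ?J (m + 1)) \<subseteq> Ass (ideal_pow ?J m)" if "m \<ge> 2" for m
        using Ass_pow_cover_ideal_bipartite[where 'k = 'k, OF assms(1) b, of "m + 1"] edges[of m] that
        by force
    qed
  next
    assume "almost_bipartite E"
    then obtain S where S: "induced_odd_cycle E S" "\<And>S'. induced_odd_cycle E S' \<Longrightarrow> S' = S"
      unfolding almost_bipartite_def by blast
    have sub: "Ass (ideal_pow ?J m) \<subseteq> insert (?p S) {?p {u, v} |u v. E u v}" for m
      using Ass_pow_cover_ideal_almost_bipartite[OF assms(1) S(1)] S(2) by blast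
    show thesis
    proof
      show "Ass (ideal_pow ?J m) \<subseteq> insert (?p S) {?p {u, v} |u v. E u v}" for m
        by (rule sub)
      show "Ass (ideal_pow ?J (m + 1)) \<subseteq> Ass (ideal_pow ?J m)" if "m \<ge> 2" for m
        using sub[of "m + 1"] edges[of m] odd_cycle_prime_in_Ass[where 'k = 'k, OF assms(1) S(1) that] that
        by force
    qed
  qed
  have "monomial_prime (?p S)" unfolding monomial_prime_def by blast
  moreover have "Ass (ideal_pow ?J (m + 1)) \<subseteq> Ass (ideal_pow ?J m) \<union> {?p S}" if "1 \<le> m \<and> m \<le> 1" for m
    using bound[of "m + 1"] edges[of m] that by force
  moreover have "Ass (ideal_pow ?J (m + 1)) \<subseteq> Ass (ideal_pow ?J m)" if "m \<ge> 1 + 1" for m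
    using pers that by simp
  ultimately show "nearly_copersistent ?J"
    unfolding nearly_copersistent_def by (intro exI[of _ 1] exI[of _ "?p S"]) auto
qed

end
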